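(* A class of simple graphs has bounded rank-depth if and only if it has bounded shrub-depth.
   Context: A connectivity function on a finite set $E$ is a function $\lambda:2^E\to\mathbb{Z}$ with $\lambda(\emptyset)=0$, $\lambda(X)=\lambda(E\setminus X)$, and $\lambda(X)+\lambda(Y)\ge\lambda(X\cup Y)+\lambda(X\cap Y)$. The radius of a tree is the minimum $r$ such that some node has distance at most $r$ from every node. A decomposition of $\lambda$ is a pair $(T,\sigma)$ where $T$ is a tree with at least one internal node and $\sigma$ is a bijection from $E$ to the leaves of $T$. For an internal node $v$, the components of $T-v$ induce via $\sigma$ a partition $\mathcal P_v$ of $E$; the width of $v$ is $\max_{\mathcal P'\subseteq\mathcal P_v}\lambda(\bigcup_{X\in\mathcal P'}X)$, and the width of $(T,\sigma)$ is the maximum width of an internal node. A $(k,r)$-decomposition has width at most $k$ and radius (of $T$) at most $r$. The branch-depth of $\lambda$ is the minimum $k$ with a $(k,k)$-decomposition, and is $0$ if $|E|<2$. For a simple graph $G=(V,E)$ and $X\subseteq V$, the cut-rank $\rho_G(X)$ is the rank over the binary field of the $X\times(V\setminus X)$ $0$-$1$ matrix whose $(i,j)$ entry is $1$ iff $i,j$ are adjacent; the rank-depth of $G$ is the branch-depth of $\rho_G$. A $(k,d)$-shrubbery for $G$ is a rooted tree $T$ whose set of leaves is $V$, all at distance exactly $d$ from the root, together with $f:V\to\{1,\dots,k\}$ such that whenever $(x_1,y_1),(x_2,y_2)\in V^2$ satisfy $\mathrm{dist}_T(x_1,y_1)=\mathrm{dist}_T(x_2,y_2)$, $f(x_1)=f(x_2)$,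 $f(y_1)=f(y_2)$, we have $x_1y_1\in E$ iff $x_2y_2\in E$. A class has bounded shrub-depth if there exist integers $k,d$ such that every graph in the class admits a $(k,d)$-shrubbery; it has bounded rank-depth if there is an integer bounding the rank-depth of all its members. *)

theory Defs
  imports
    "Graph_Theory.Graph_Theory"
    "HOL-Library.Z2"
    "HOL-Library.Function_Algebras"
begin

section \<open>Trees\<close>

text \<open>
  A finite simple graph is a \<^locale>\<open>pair_graph\<close>: finite, loop-free and symmetric, so an undirected
  edge \<open>uv\<close> is the pair of arcs \<open>(u,v)\<close>, \<open>(v,u)\<close>. In such a graph \<open>u, v, u\<close> counts as a
  \<open>cycle\<close>, which is why \<open>Digraph_Component.tree\<close> is not usable here and the length bound is needed.
  The predicate \<open>connected\<close> of the library includes that there is at least one vertex.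
\<close>

definition is_tree :: "'n pair_pre_digraph \<Rightarrow> bool" where
  "is_tree T \<longleftrightarrow> pair_graph T \<and> Digraph_Component.connected (with_proj T) \<and>
     \<not> (\<exists>p. pre_digraph.cycle (with_proj T) p \<and> 3 \<le> length p)"

definition graph_dist :: "'n pair_pre_digraph \<Rightarrow> 'n \<Rightarrow> 'n \<Rightarrow> nat" where
  "graph_dist T u v = (LEAST n. \<exists>p. pre_digraph.awalk (with_proj T) u p v \<and> length p = n)"

definition radius :: "'n pair_pre_digraph \<Rightarrow> nat" where
  "radius T = (LEAST r. \<exists>u \<in> pverts T. \<forall>v \<in> pverts T. graph_dist T u v \<le> r)"

text \<open>By symmetry of the arc relation, \<open>out_degree\<close> is the undirected degree.\<close>

definition leaves :: "'n pair_pre_digraph \<Rightarrow> 'n set" where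
  "leaves T = {v \<in> pverts T. out_degree (with_proj T) v = 1}"

definition internal_nodes :: "'n pair_pre_digraph \<Rightarrow> 'n set" where
  "internal_nodes T = {v \<in> pverts T. 2 \<le> out_degree (with_proj T) v}"


section \<open>Branch-depth\<close>

text \<open>
  The function \<open>l :: 'e set \<Rightarrow> int\<close> stands for a connectivity function on \<open>E\<close>; the definitions
  below do not depend on its axioms.
\<close>

definition decomposition ::
    "'e set \<Rightarrow> 'n pair_pre_digraph \<Rightarrow> ('e \<Rightarrow> 'n) \<Rightarrow> bool" where
  "decomposition E T \<sigma> \<longleftrightarrow> is_tree T \<and> internal_nodes T \<noteq> {} \<and> bij_betw \<sigma> E (leaves T)"

text \<open>
  As \<open>T\<close> is symmetric, the strongly connected components of \<open>T - v\<close> are its connected components.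
\<close>

definition node_partition ::
    "'e set \<Rightarrow> 'n pair_pre_digraph \<Rightarrow> ('e \<Rightarrow> 'n) \<Rightarrow> 'n \<Rightarrow> 'e set set" where
  "node_partition E T \<sigma> v =
     (\<lambda>S. {e \<in> E. \<sigma> e \<in> S}) ` pre_digraph.sccs_verts (pre_digraph.del_vert (with_proj T) v)"

definition node_width ::
    "'e set \<Rightarrow> ('e set \<Rightarrow> int) \<Rightarrow> 'n pair_pre_digraph \<Rightarrow> ('e \<Rightarrow> 'n) \<Rightarrow> 'n \<Rightarrow> int" where
  "node_width E l T \<sigma> v = Max {l (\<Union>P) | P. P \<subseteq> node_partition E T \<sigma> v}"

definition decomposition_width ::
    "'e set \<Rightarrow> ('e set \<Rightarrow> int) \<Rightarrow> 'n pair_pre_digraph \<Rightarrow> ('e \<Rightarrow> 'n) \<Rightarrow> int" where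
  "decomposition_width E l T \<sigma> = Max (node_width E l T \<sigma> ` internal_nodes T)"

definition kr_decomposition ::
    "nat \<Rightarrow> nat \<Rightarrow> 'e set \<Rightarrow> ('e set \<Rightarrow> int) \<Rightarrow> 'n pair_pre_digraph \<Rightarrow> ('e \<Rightarrow> 'n) \<Rightarrow> bool" where
  "kr_decomposition k r E l T \<sigma> \<longleftrightarrow>
     decomposition E T \<sigma> \<and> decomposition_width E l T \<sigma> \<le> int k \<and> radius T \<le> r"

text \<open>
  Trees are finite, so up to isomorphism they all occur among the trees on natural numbers.
  If \<open>E\<close> is finite with at least two elements, a star yields a decomposition, so the minimum exists.
\<close>

definition branch_depth :: "'e set \<Rightarrow> ('e set \<Rightarrow> int) \<Rightarrow> nat" where
  "branch_depth E l =
     (if card E < 2 then 0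
      else LEAST k. \<exists>(T :: nat pair_pre_digraph) \<sigma>. kr_decomposition k k E l T \<sigma>)"


section \<open>Rank-depth\<close>

interpretation bit_fun: vector_space "\<lambda>(c :: bit) (v :: 'a \<Rightarrow> bit) j. c * v j"
  by unfold_locales (auto simp: fun_eq_iff algebra_simps)

text \<open>
  Rows of the \<open>X \<times> (V - X)\<close> matrix, extended by \<open>0\<close> to functions on the whole type (which does not
  change the rank). As for \<open>rank\<close> in \<open>HOL-Analysis\<close>, the rank is the dimension of the row space.
\<close>

definition cut_row :: "'a pair_pre_digraph \<Rightarrow> 'a set \<Rightarrow> 'a \<Rightarrow> 'a \<Rightarrow> bit" where
  "cut_row G X i = (\<lambda>j. if j \<in> pverts G - X \<and> (i, j) \<in> parcs G then 1 else 0)"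

definition cut_rank :: "'a pair_pre_digraph \<Rightarrow> 'a set \<Rightarrow> nat" where
  "cut_rank G X = bit_fun.dim (cut_row G X ` X)"

definition rank_depth :: "'a pair_pre_digraph \<Rightarrow> nat" where
  "rank_depth G = branch_depth (pverts G) (\<lambda>X. int (cut_rank G X))"

definition bounded_rank_depth :: "'a pair_pre_digraph set \<Rightarrow> bool" where
  "bounded_rank_depth \<C> \<longleftrightarrow> (\<exists>n. \<forall>G \<in> \<C>. rank_depth G \<le> n)"


section \<open>Shrub-depth\<close>

text \<open>
  A leaf of a rooted tree is a node without children; the root is a leaf only if it is the only
  node, even if it has degree one.
\<close>

definition children :: "'n pair_pre_digraph \<Rightarrow> 'n \<Rightarrow> 'n \<Rightarrow> 'n set" where
  "children T r v = {w. (v, w) \<in> parcs T \<and> graph_dist T r w = graph_dist T r v + 1}"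

definition rooted_leaves :: "'n pair_pre_digraph \<Rightarrow> 'n \<Rightarrow> 'n set" where
  "rooted_leaves T r = {v \<in> pverts T. children T r v = {}}"

text \<open>
  The bijection \<open>\<sigma>\<close> identifies the vertices of \<open>G\<close> with the leaves of \<open>T\<close>, so that the node
  type of \<open>T\<close> need not be the vertex type of \<open>G\<close>.
\<close>

definition shrubbery ::
    "nat \<Rightarrow> nat \<Rightarrow> 'a pair_pre_digraph \<Rightarrow> 'n pair_pre_digraph \<Rightarrow> 'n \<Rightarrow> ('a \<Rightarrow> 'n) \<Rightarrow> ('a \<Rightarrow> nat) \<Rightarrow> bool"
  where
  "shrubbery k d G T r \<sigma> f \<longleftrightarrow>
     is_tree T \<and> r \<in> pverts T \<and>
     bij_betw \<sigma> (pverts G) (rooted_leaves T r) \<and>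
     (\<forall>x \<in> pverts G. graph_dist T r (\<sigma> x) = d) \<and>
     (\<forall>x \<in> pverts G. f x \<in> {1..k}) \<and>
     (\<forall>x\<^sub>1 \<in> pverts G. \<forall>y\<^sub>1 \<in> pverts G. \<forall>x\<^sub>2 \<in> pverts G. \<forall>y\<^sub>2 \<in> pverts G.
        graph_dist T (\<sigma> x\<^sub>1) (\<sigma> y\<^sub>1) = graph_dist T (\<sigma> x\<^sub>2) (\<sigma> y\<^sub>2) \<and> f x\<^sub>1 = f x\<^sub>2 \<and> f y\<^sub>1 = f y\<^sub>2 \<longrightarrow>
        ((x\<^sub>1, y\<^sub>1) \<in> parcs G \<longleftrightarrow> (x\<^sub>2, y\<^sub>2) \<in> parcs G))"

definition bounded_shrub_depth :: "'a pair_pre_digraph set \<Rightarrow> bool" where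
  "bounded_shrub_depth \<C> \<longleftrightarrow>
     (\<exists>k d. \<forall>G \<in> \<C>. \<exists>(T :: nat pair_pre_digraph) r \<sigma> f. shrubbery k d G T r \<sigma> f)"

end

theory Submission
  imports Defs
begin

text \<open>
  A shrubbery of depth \<open>d\<close> is a nested sequence of partitions of the vertex set, and so is a rooted
  decomposition in which short branches are prolonged. It remains to compare the two conditions at a
  single node \<open>v\<close>. If adjacency is governed by labels, then the row of a vertex \<open>x\<close> across a union of
  parts at \<open>v\<close> depends only on the label of \<open>x\<close> and on the level where \<open>x\<close> branches off from \<open>v\<close>,
  so the cut-rank is bounded. Conversely, if all unions of parts at \<open>v\<close> have cut-rank at most \<open>n\<close>,
  they have at most \<open>2 ^ n\<close> distinct rows, and then boundedly many types of vertices determine the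
  adjacency between different parts. A vertex is labelled with its types at all its ancestors and
  with the corresponding adjacency tables.
\<close>

section \<open>Walks and components\<close>

text \<open>A rank bound leaves few rows for each single bipartition, but a node with many children
  has unboundedly many unions of parts, and vertices with equal rows across one union may be told
  apart by another. Fixing one bipartition with as many rows as possible removes this dependence and
  yields types valid for all pairs of parts at once. A second obstacle is that a shrubbery sees only
  the distance of two leaves, thus the level but not the node where they diverge. Types at different
  nodes are numbered independently, so the adjacency table of the node must be part of the label:
  equal labels then force equal tables. The two kinds of tree also disagree about leaves. In a
  decomposition every node of degree one is a leaf, even a root with one child, so common initial
  levels of a shrubbery are cut off; elsewhere a node with a single child has degree two and is
  harmless. Conversely, rooting a decomposition of radius \<open>n\<close> at any internal node
  gives depth at most \<open>2 * n\<close>.\<close>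

definition conn_avoiding :: "'n pair_pre_digraph \<Rightarrow> 'n \<Rightarrow> 'n rel" where
  "conn_avoiding T v = {(a, b). (a, b) \<in> parcs T \<and> a \<noteq> v \<and> b \<noteq> v}\<^sup>*"

text \<open>Trades arc lists for relation powers, so that distances can be computed by induction on
  single steps.\<close>

lemma (in pair_wf_digraph) awalk_length_iff_relpow:
  assumes "u \<in> pverts G"
  shows "(\<exists>p. awalk u p v \<and> length p = n) \<longleftrightarrow> (u, v) \<in> parcs G ^^ n"
  using assms
proof (induction n arbitrary: u)
  case 0
  then show ?case by (auto simp: awalk_Nil_iff)
next
  case (Suc n)
  have "(\<exists>p. awalk u p v \<and> length p = Suc n) \<longleftrightarrow>
      (\<exists>w p. (u, w) \<in> parcs G \<and> awalk w p v \<and> length p = n)"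
    (is "?L \<longleftrightarrow> ?R")
  proof
    assume ?L
    then obtain e p where "awalk u (e # p) v" "length p = n"
      by (auto simp: length_Suc_conv)
    then show ?R by (cases e) (auto simp: awalk_Cons_iff)
  next
    assume ?R
    then obtain w p where "(u, w) \<in> parcs G" "awalk w p v" "length p = n"
      by blast
    then have "awalk u ((u, w) # p) v" "length ((u, w) # p) = Suc n"
      by (auto simp: awalk_Cons_iff)
    then show ?L by blast
  qed
  also have "\<dots> \<longleftrightarrow> (\<exists>w. (u, w) \<in> parcs G \<and> (w, v) \<in> parcs G ^^ n)"
    using Suc.IH wellformed'(2) by blast
  also have "\<dots> \<longleftrightarrow> (u, v) \<in> parcs G ^^ Suc n"
    by (meson relpow_Suc_D2 relpow_Suc_I2)
  finally show ?case .
qed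

lemma (in pair_wf_digraph) graph_dist_eq_relpow:
  assumes "u \<in> pverts G"
  shows "graph_dist G u v = (LEAST n. (u, v) \<in> parcs G ^^ n)"
  unfolding graph_dist_def
  using awalk_length_iff_relpow[OF assms] by simp

lemma (in pair_wf_digraph) graph_dist_le:
  assumes "u \<in> pverts G" "(u, v) \<in> parcs G ^^ n"
  shows "graph_dist G u v \<le> n"
  using assms by (simp add: graph_dist_eq_relpow Least_le)

lemma (in pair_wf_digraph) relpow_graph_dist:
  assumes "u \<in> pverts G" "(u, v) \<in> (parcs G)\<^sup>*"
  shows "(u, v) \<in> parcs G ^^ graph_dist G u v"
  unfolding graph_dist_eq_relpow[OF assms(1)]
  using rtrancl_imp_relpow[OF assms(2)] by (auto intro: LeastI)

lemma (in pair_wf_digraph) graph_dist_self: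
  "u \<in> pverts G \<Longrightarrow> graph_dist G u u = 0"
  using graph_dist_le[of u u 0] by simp

lemma (in pair_sym_digraph) connected_iff_rtrancl:
  "Digraph_Component.connected (with_proj G) \<longleftrightarrow>
     pverts G \<noteq> {} \<and> (\<forall>u \<in> pverts G. \<forall>v \<in> pverts G. (u, v) \<in> (parcs G)\<^sup>*)"
proof -
  have "(parcs G)\<^sup>s = parcs G"
    using arcs_symmetric by (auto simp: symcl_def)
  then show ?thesis
    using reachable_conv by (auto simp: connected_conv reachable_def)
qed

lemma (in pair_sym_digraph) conn_avoiding_sym: "sym (conn_avoiding G v)"
  unfolding conn_avoiding_def
  by (rule sym_rtrancl) (auto simp: sym_def intro: arcs_symmetric)

text \<open>In a symmetric digraph reachability is an equivalence, so the strong component of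
  \<open>a\<close> is everything reachable from \<open>a\<close>.\<close>

lemma (in pair_sym_digraph) sccs_verts_del_vert:
  "pre_digraph.sccs_verts (pre_digraph.del_vert (with_proj G) v) =
     (\<lambda>a. conn_avoiding G v `` {a}) ` (pverts G - {v})"
proof -
  let ?H = "pre_digraph.del_vert (with_proj G) v"
  have ends: "arcs_ends ?H = {(a, b). (a, b) \<in> parcs G \<and> a \<noteq> v \<and> b \<noteq> v}"
    by (auto simp: arcs_ends_conv pre_digraph.del_vert_simps image_iff)
  have wf: "wf_digraph ?H" by (rule wf_digraph_del_vert)
  interpret H: sym_digraph ?H
    using wf by (rule wf_digraph.sym_digraphI)
      (auto simp: symmetric_def ends sym_def intro: arcs_symmetric)
  have reach: "u \<rightarrow>\<^sup>*\<^bsub>?H\<^esub> w \<longleftrightarrow> (u, w) \<in> conn_avoiding G v" if "u \<in> pverts G - {v}" for u w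
    using that by (subst H.reachable_conv') (auto simp: pre_digraph.del_vert_simps ends conn_avoiding_def)
  have "H.scc_of a = conn_avoiding G v `` {a}" if "a \<in> pverts G - {v}" for a
    using that H.symmetric_reachable' by (auto simp: H.scc_of_def reach)
  then show ?thesis
    by (simp add: H.sccs_verts_conv_scc_of pre_digraph.del_vert_simps)
qed

lemma (in pair_wf_digraph) out_degree_eq_card:
  "out_degree (with_proj G) v = card {w. (v, w) \<in> parcs G}"
proof -
  have "out_arcs (with_proj G) v = Pair v ` {w. (v, w) \<in> parcs G}"
    by (auto simp: out_arcs_def)
  then show ?thesis
    by (simp add: out_degree_def card_image inj_on_def)
qed

section \<open>Rooted trees given by a parent function\<close>

text \<open>Common form for given trees and for trees built from layerings. The height dropping
  along \<open>par\<close> takes the place of acyclicity and connectedness, both of which are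
  derived below; nothing is assumed about \<open>par r\<close>.\<close>

locale parent_tree =
  fixes T :: "'n pair_pre_digraph" and r :: 'n and par :: "'n \<Rightarrow> 'n" and h :: "'n \<Rightarrow> nat"
  assumes finite_nodes: "finite (pverts T)"
    and root_in: "r \<in> pverts T"
    and height_root: "h r = 0"
    and par_in: "v \<in> pverts T \<Longrightarrow> v \<noteq> r \<Longrightarrow> par v \<in> pverts T"
    and height_par: "v \<in> pverts T \<Longrightarrow> v \<noteq> r \<Longrightarrow> h v = Suc (h (par v))"
    and arcs_iff: "(u, v) \<in> parcs T \<longleftrightarrow> u \<in> pverts T \<and> v \<in> pverts T \<and>
      (u \<noteq> r \<and> v = par u \<or> v \<noteq> r \<and> u = par v)"
begin

lemma height_eq_0: "v \<in> pverts T \<Longrightarrow> h v = 0 \<Longrightarrow> v = r"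
  using height_par by fastforce

lemma par_arc: "v \<in> pverts T \<Longrightarrow> v \<noteq> r \<Longrightarrow> (v, par v) \<in> parcs T \<and> (par v, v) \<in> parcs T"
  using par_in arcs_iff by auto

lemma arc_heights: "(u, v) \<in> parcs T \<Longrightarrow> h u = Suc (h v) \<or> h v = Suc (h u)"
  using arcs_iff height_par by auto

lemma pair_graph_T: "pair_graph T"
proof -
  have sub: "parcs T \<subseteq> pverts T \<times> pverts T"
    using arcs_iff by auto
  show ?thesis
  proof unfold_locales
    show "finite (pverts T)" by (rule finite_nodes)
    show "finite (parcs T)"
      using sub finite_nodes by (meson finite_SigmaI finite_subset)
    show "symmetric (with_proj T)"
      by (auto simp: symmetric_def sym_def arcs_iff)
  next
    fix e assume "e \<in> parcs T"
    then show "fst e \<noteq> snd e"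
      using arc_heights[of "fst e" "snd e"] by auto
  qed (use sub in auto)
qed

sublocale pair_graph T by (rule pair_graph_T)

lemma induct_up [consumes 1, case_names root child]:
  assumes "v \<in> pverts T" "P r"
    and "\<And>v. v \<in> pverts T \<Longrightarrow> v \<noteq> r \<Longrightarrow> P (par v) \<Longrightarrow> P v"
  shows "P v"
  using assms(1)
proof (induction "h v" arbitrary: v)
  case 0
  then show ?case using height_eq_0 assms(2) by metis
next
  case (Suc n)
  then have "v \<noteq> r" using height_root by auto
  with Suc show ?case using assms(3) par_in height_par by auto
qed

lemma to_root: "v \<in> pverts T \<Longrightarrow> (v, r) \<in> (parcs T)\<^sup>*"
proof (induction v rule: induct_up)
  case (child v)
  then show ?case using par_arc by (meson converse_rtrancl_into_rtrancl)
qed simp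

lemma all_connected:
  assumes "u \<in> pverts T" "v \<in> pverts T"
  shows "(u, v) \<in> (parcs T)\<^sup>*"
proof -
  have "sym ((parcs T)\<^sup>*)"
    using arcs_symmetric by (intro sym_rtrancl) (auto simp: sym_def)
  then show ?thesis
    using to_root[OF assms(1)] to_root[OF assms(2)] by (meson rtrancl_trans symE)
qed

lemma connected_T: "Digraph_Component.connected (with_proj T)"
  unfolding connected_iff_rtrancl using all_connected root_in by auto

text \<open>Truncated subtraction gives \<open>anc j v = v\<close> for every \<open>j\<close> above
  the height of \<open>v\<close>. This is how short branches are prolonged without adding
  nodes.\<close>

definition anc :: "nat \<Rightarrow> 'n \<Rightarrow> 'n" where
  "anc j v = (par ^^ (h v - j)) v"

lemma anc_ge: "h v \<le> j \<Longrightarrow> anc j v = v"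
  by (simp add: anc_def)

lemma anc_par:
  assumes "v \<in> pverts T" "j < h v"
  shows "anc j v = anc j (par v)"
proof -
  have "v \<noteq> r" using assms height_root by auto
  then have "h v - j = Suc (h (par v) - j)"
    using assms height_par by auto
  then show ?thesis
    by (simp add: anc_def funpow_swap1)
qed

lemma anc_in_height:
  assumes "v \<in> pverts T"
  shows "anc j v \<in> pverts T" "h (anc j v) = min j (h v)"
proof -
  have "anc j v \<in> pverts T \<and> h (anc j v) = min j (h v)"
    using assms
  proof (induction v rule: induct_up)
    case root
    then show ?case by (simp add: anc_def height_root root_in)
  next
    case (child v)
    then show ?case
      using anc_par[of v j] anc_ge[of v j] height_par[of v]
      by (cases "j < h v") auto
  qed
  then show "anc j v \<in> pverts T" "h (anc j v) = min j (h v)" by auto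
qed

lemma anc_anc:
  assumes "v \<in> pverts T" "i \<le> j"
  shows "anc i (anc j v) = anc i v"
  using assms
proof (induction v rule: induct_up)
  case root
  then show ?case by (simp add: anc_ge height_root)
next
  case (child v)
  then show ?case
    using anc_par[of v j] anc_par[of v i] anc_ge[of v j]
    by (cases "j < h v") auto
qed

lemma par_anc_Suc:
  assumes "v \<in> pverts T" "j < h v"
  shows "par (anc (Suc j) v) = anc j v"
proof -
  let ?w = "anc (Suc j) v"
  have w: "?w \<in> pverts T" "h ?w = Suc j"
    using anc_in_height[of v "Suc j"] assms by auto
  then have "?w \<noteq> r" using height_root by auto
  then have "h (par ?w) = j" using height_par w by auto
  then have "par ?w = anc j (par ?w)" by (simp add: anc_ge)
  also have "\<dots> = anc j v"
    using anc_par[of ?w j] anc_anc[of v j "Suc j"] w assms by simp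
  finally show ?thesis .
qed

section \<open>Distances from ancestor chains\<close>

definition Anc :: "'n \<Rightarrow> 'n set" where
  "Anc v = (\<lambda>j. anc j v) ` {..h v}"

lemma finite_Anc: "finite (Anc v)"
  by (simp add: Anc_def)

lemma Anc_root: "Anc r = {r}"
  by (simp add: Anc_def height_root anc_ge)

lemma Anc_child:
  assumes "v \<in> pverts T" "v \<noteq> r"
  shows "Anc v = insert v (Anc (par v))"
proof -
  have "{..h v} = insert (h v) {..h (par v)}"
    using height_par[OF assms] by auto
  moreover have "(\<lambda>j. anc j v) ` {..h (par v)} = (\<lambda>j. anc j (par v)) ` {..h (par v)}"
    using anc_par assms height_par by (intro image_cong) auto
  ultimately show ?thesis by (simp add: Anc_def anc_ge)
qed

lemma root_in_Anc: "v \<in> pverts T \<Longrightarrow> r \<in> Anc v"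
  by (induction v rule: induct_up) (auto simp: Anc_root Anc_child)

lemma self_in_Anc: "v \<in> Anc v"
  using anc_ge[of v "h v"] by (force simp: Anc_def)

lemma Anc_height: "v \<in> pverts T \<Longrightarrow> u \<in> Anc v \<Longrightarrow> h u \<le> h v \<and> u \<in> pverts T \<and> u = anc (h u) v"
  using anc_in_height by (auto simp: Anc_def)

lemma Anc_height_eq: "v \<in> pverts T \<Longrightarrow> u \<in> Anc v \<Longrightarrow> h u = h v \<Longrightarrow> u = v"
  using Anc_height anc_ge by fastforce

lemma self_notin_Anc_par: "v \<in> pverts T \<Longrightarrow> v \<noteq> r \<Longrightarrow> v \<notin> Anc (par v)"
  using Anc_height[of "par v" v] par_in height_par by fastforce

text \<open>The tree distance: the path from \<open>u\<close> to \<open>v\<close> turns at their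
  deepest common ancestor and has one edge for each node lying on exactly one of the two chains.
  Counting differences avoids naming the turning point.\<close>

definition apart :: "'n \<Rightarrow> 'n \<Rightarrow> nat" where
  "apart u v = card (Anc u - Anc v) + card (Anc v - Anc u)"

lemma apart_comm: "apart u v = apart v u"
  by (simp add: apart_def)

text \<open>The chains of \<open>v\<close> and \<open>par v\<close> differ only in \<open>v\<close>,
  so the count changes by one, in the direction decided by whether \<open>v\<close> lies on the
  chain of \<open>w\<close>.\<close>

lemma apart_par:
  assumes "v \<in> pverts T" "v \<noteq> r"
  shows "v \<notin> Anc w \<Longrightarrow> apart v w = Suc (apart (par v) w)"
    and "v \<in> Anc w \<Longrightarrow> apart (par v) w = Suc (apart v w)"
proof -
  note A = Anc_child[OF assms] and n = self_notin_Anc_par[OF assms]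
  show "apart v w = Suc (apart (par v) w)" if "v \<notin> Anc w"
  proof -
    have "Anc v - Anc w = insert v (Anc (par v) - Anc w)" "Anc w - Anc v = Anc w - Anc (par v)"
      using A that by auto
    then show ?thesis using n by (simp add: apart_def finite_Anc)
  qed
  show "apart (par v) w = Suc (apart v w)" if "v \<in> Anc w"
  proof -
    have "Anc v - Anc w = Anc (par v) - Anc w" "Anc w - Anc (par v) = insert v (Anc w - Anc v)"
      using A that n by auto
    moreover have "v \<notin> Anc w - Anc v" using A by simp
    ultimately show ?thesis by (simp only: apart_def) (simp add: finite_Anc)
  qed
qed

text \<open>One step changes \<open>apart\<close> by at most one; hence no walk is shorter than
  \<open>apart\<close>.\<close>

lemma apart_arc:
  assumes "(u, v) \<in> parcs T"
  shows "apart u w \<le> Suc (apart v w)"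
proof -
  have *: "apart x w \<le> Suc (apart (par x) w) \<and> apart (par x) w \<le> Suc (apart x w)"
    if "x \<in> pverts T" "x \<noteq> r" for x
    using apart_par[OF that, of w] by (cases "x \<in> Anc w") linarith+
  from assms consider "u \<in> pverts T" "u \<noteq> r" "v = par u" | "v \<in> pverts T" "v \<noteq> r" "u = par v"
    unfolding arcs_iff by blast
  then show ?thesis using *[of u] *[of v] by cases blast+
qed

lemma apart_le_relpow: "(u, v) \<in> parcs T ^^ n \<Longrightarrow> apart u v \<le> n"
proof (induction n arbitrary: u)
  case 0
  then show ?case by (simp add: apart_def)
next
  case (Suc n)
  then obtain w where "(u, w) \<in> parcs T" "(w, v) \<in> parcs T ^^ n"
    by (meson relpow_Suc_D2)
  then have "apart u v \<le> Suc (apart w v)" "apart w v \<le> n"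
    using Suc.IH apart_arc by blast+
  then show ?case by simp
qed

text \<open>A walk of the right length arises by climbing at an endpoint that is not an ancestor of
  the other; \<open>apart_par\<close> says that each such step brings the endpoints closer.\<close>

lemma relpow_apart:
  assumes "u \<in> pverts T" "v \<in> pverts T"
  shows "(u, v) \<in> parcs T ^^ apart u v"
  using assms
proof (induction "apart u v" arbitrary: u v)
  case 0
  then have "u \<in> Anc v" "v \<in> Anc u"
    using self_in_Anc[of u] self_in_Anc[of v] finite_Anc by (auto simp: apart_def)
  then have "u = v"
    using 0 Anc_height Anc_height_eq by (metis le_antisym)
  with 0 show ?case by simp
next
  case (Suc n)
  show ?case
  proof (cases "u \<in> Anc v")
    case False
    have "u \<noteq> r"
      using root_in_Anc[OF Suc.prems(2)] False by blast
    then have "n = apart (par u) v"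
      using apart_par(1)[OF Suc.prems(1)] False Suc.hyps(2) by auto
    then have "(par u, v) \<in> parcs T ^^ n"
      using Suc.hyps(1)[of "par u" v] Suc.prems par_in \<open>u \<noteq> r\<close> by auto
    then show ?thesis
      using par_arc[of u] Suc.prems \<open>u \<noteq> r\<close> Suc.hyps(2) relpow_Suc_I2 by metis
  next
    case True
    then have "v \<notin> Anc u"
    proof -
      have "u \<noteq> v" using Suc.hyps(2) by (auto simp: apart_def)
      then show ?thesis using True Anc_height Anc_height_eq Suc.prems by (metis le_antisym)
    qed
    have "v \<noteq> r"
      using root_in_Anc[OF Suc.prems(1)] \<open>v \<notin> Anc u\<close> by blast
    then have "n = apart u (par v)"
      using apart_par(1)[OF Suc.prems(2)] \<open>v \<notin> Anc u\<close> Suc.hyps(2) apart_comm by (metis nat.inject)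
    then have "(u, par v) \<in> parcs T ^^ n"
      using Suc.hyps(1)[of u "par v"] Suc.prems par_in \<open>v \<noteq> r\<close> by auto
    then show ?thesis
      using par_arc[of v] Suc.prems \<open>v \<noteq> r\<close> Suc.hyps(2) relpow_Suc_I by metis
  qed
qed

lemma graph_dist_eq_apart:
  assumes "u \<in> pverts T" "v \<in> pverts T"
  shows "graph_dist T u v = apart u v"
  unfolding graph_dist_eq_relpow[OF assms(1)]
  using relpow_apart[OF assms] apart_le_relpow by (intro Least_equality)

lemma card_Anc: "v \<in> pverts T \<Longrightarrow> card (Anc v) = Suc (h v)"
proof (induction v rule: induct_up)
  case root
  then show ?case by (simp add: Anc_root height_root)
next
  case (child v)
  then show ?case
    using self_notin_Anc_par finite_Anc by (simp add: Anc_child height_par[of v])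
qed

lemma graph_dist_root:
  assumes "v \<in> pverts T"
  shows "graph_dist T r v = h v"
proof -
  have "apart r v = card (Anc v - {r})"
    using root_in_Anc[OF assms] by (simp add: apart_def Anc_root)
  also have "\<dots> = h v"
    using root_in_Anc[OF assms] by (simp add: finite_Anc card_Anc[OF assms])
  finally show ?thesis
    using graph_dist_eq_apart root_in assms by simp
qed

lemma card_Anc_diff:
  assumes "u \<in> pverts T" "v \<in> pverts T" "h u = d" "h v = d"
  shows "card (Anc u - Anc v) = card {j. j \<le> d \<and> anc j u \<noteq> anc j v}"
proof -
  have "Anc u - Anc v = (\<lambda>j. anc j u) ` {j. j \<le> d \<and> anc j u \<noteq> anc j v}"
  proof (intro set_eqI iffI)
    fix w assume w: "w \<in> Anc u - Anc v"
    then have "w = anc (h w) u" "h w \<le> d" using Anc_height assms by auto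
    moreover have "anc (h w) u \<noteq> anc (h w) v"
      using w calculation assms by (auto simp: Anc_def)
    ultimately show "w \<in> (\<lambda>j. anc j u) ` {j. j \<le> d \<and> anc j u \<noteq> anc j v}" by blast
  next
    fix w assume "w \<in> (\<lambda>j. anc j u) ` {j. j \<le> d \<and> anc j u \<noteq> anc j v}"
    then obtain j where j: "j \<le> d" "anc j u \<noteq> anc j v" "w = anc j u" by auto
    then have "h w = j" using anc_in_height(2)[OF assms(1)] assms by auto
    then have "w \<notin> Anc v" using j Anc_height[OF assms(2), of w] by auto
    then show "w \<in> Anc u - Anc v" using j assms by (auto simp: Anc_def)
  qed
  moreover have "inj_on (\<lambda>j. anc j u) {j. j \<le> d \<and> anc j u \<noteq> anc j v}"
    using anc_in_height(2)[OF assms(1)] assms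
    by (intro inj_onI) (metis (no_types, lifting) mem_Collect_eq min.absorb1)
  ultimately show ?thesis by (simp add: card_image)
qed

text \<open>For nodes of equal height the two chains differ on the same levels, hence the factor 2.
  Equality of distances becomes equality of the numbers of such levels.\<close>

lemma graph_dist_level:
  assumes "u \<in> pverts T" "v \<in> pverts T" "h u = d" "h v = d"
  shows "graph_dist T u v = 2 * card {j. j \<le> d \<and> anc j u \<noteq> anc j v}"
proof -
  have "{j. j \<le> d \<and> anc j v \<noteq> anc j u} = {j. j \<le> d \<and> anc j u \<noteq> anc j v}" by auto
  then show ?thesis
    using card_Anc_diff[OF assms] card_Anc_diff[OF assms(2,1,4,3)] assms
    by (simp add: graph_dist_eq_apart apart_def)
qed

end

section \<open>Acyclicity of a parent tree and its components after deleting a node\<close>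

lemma pcas_nth_fst:
  "pcas u p v \<Longrightarrow> i < length p \<Longrightarrow> fst (p ! i) = (if i = 0 then u else snd (p ! (i - 1)))"
proof (induction p arbitrary: u i)
  case (Cons e p)
  then show ?case by (cases i; cases "i - 1") auto
qed simp

lemma pcas_last: "pcas u p v \<Longrightarrow> p \<noteq> [] \<Longrightarrow> v = snd (p ! (length p - 1))"
proof (induction p arbitrary: u)
  case (Cons e p)
  then show ?case by (cases p) auto
qed simp

lemma tl_pawalk_verts: "pcas u p v \<Longrightarrow> tl (pawalk_verts u p) = map snd p"
proof (induction p arbitrary: u)
  case (Cons e p)
  then show ?case by (cases p) auto
qed simp

context parent_tree
begin

lemma arc_to_higher: "(a, v) \<in> parcs T \<Longrightarrow> h a \<le> h v \<Longrightarrow> v \<noteq> r \<and> a = par v"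
  using height_par unfolding arcs_iff by auto

text \<open>Both neighbours of a highest node on a cycle would have to be its parent.\<close>

lemma no_long_cycle: "cycle p \<Longrightarrow> length p < 3"
proof (rule ccontr)
  assume "cycle p" and "\<not> length p < 3"
  then obtain u where p: "awalk u p u" "distinct (tl (pawalk_verts u p))" and n: "3 \<le> length p"
    unfolding cycle_def by auto
  then have c: "pcas u p u" and arcs: "set p \<subseteq> parcs T" by auto
  have d: "distinct (map snd p)" using p tl_pawalk_verts[OF c] by simp
  have "\<exists>i. i < length p \<and> (\<forall>j. j < length p \<longrightarrow> h (snd (p ! j)) \<le> h (snd (p ! i)))"
  proof -
    let ?S = "(\<lambda>i. h (snd (p ! i))) ` {..<length p}"
    have fin: "finite ?S" "?S \<noteq> {}"
      using n by (auto simp: lessThan_empty_iff)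
    then have "Max ?S \<in> ?S" by (rule Max_in)
    then obtain i where "i < length p" "Max ?S = h (snd (p ! i))" by blast
    moreover have "h (snd (p ! j)) \<le> Max ?S" if "j < length p" for j
      using fin that by (intro Max_ge) auto
    ultimately show ?thesis by auto
  qed
  then obtain i where i: "i < length p" and m: "\<And>j. j < length p \<Longrightarrow> h (snd (p ! j)) \<le> h (snd (p ! i))"
    by blast
  let ?v = "snd (p ! i)"
  \<comment> \<open>Cyclic successor and predecessor of \<open>i\<close>. They are distinct because
    there are at least three arcs; for the closed walk along one edge and back they would
    coincide.\<close>
  define k where "k = (if Suc i = length p then 0 else Suc i)"
  define l where "l = (if i = 0 then length p - 1 else i - 1)"
  have kl: "k < length p" "l < length p" "k \<noteq> l"
    using i n by (auto simp: k_def l_def)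
  have v: "?v = fst (p ! k)"
  proof (cases "Suc i = length p")
    case True
    then have "i = length p - 1" "p \<noteq> []" by auto
    then show ?thesis
      using True pcas_nth_fst[OF c kl(1)] pcas_last[OF c] by (simp add: k_def)
  next
    case False
    then show ?thesis using pcas_nth_fst[OF c kl(1)] by (simp add: k_def)
  qed
  have a: "fst (p ! i) = snd (p ! l)"
    using pcas_nth_fst[OF c i] pcas_last[OF c] i by (cases "i = 0") (auto simp: l_def)
  have "(snd (p ! l), ?v) \<in> parcs T"
    using arcs i a nth_mem[OF i] by (metis prod.collapse subsetD)
  then have 1: "snd (p ! l) = par ?v"
    using arc_to_higher m kl by blast
  have "(?v, snd (p ! k)) \<in> parcs T"
    using arcs v nth_mem[OF kl(1)] by (metis prod.collapse subsetD)
  then have "(snd (p ! k), ?v) \<in> parcs T" by (rule arcs_symmetric)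
  then have "snd (p ! k) = par ?v"
    using arc_to_higher m kl by blast
  with 1 have "map snd p ! k = map snd p ! l" using kl by simp
  then show False using d kl nth_eq_iff_index_eq[of "map snd p" k l] by simp
qed

lemma is_tree_T: "is_tree T"
  unfolding is_tree_def using pair_graph_T connected_T no_long_cycle by fastforce

lemma conn_avoiding_anc:
  assumes "x \<in> pverts T" "i \<le> h x" "\<And>j. i \<le> j \<Longrightarrow> j \<le> h x \<Longrightarrow> anc j x \<noteq> v"
  shows "(x, anc i x) \<in> conn_avoiding T v"
  using assms
proof (induction x rule: induct_up)
  case root
  then show ?case by (simp add: anc_ge height_root conn_avoiding_def)
next
  case (child x)
  show ?case
  proof (cases "i = h x")
    case True
    then show ?thesis by (simp add: anc_ge conn_avoiding_def)
  next
    case False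
    then have i: "i \<le> h (par x)" and hx: "h x = Suc (h (par x))"
      using child height_par by auto
    have eq: "anc j x = anc j (par x)" if "j \<le> h (par x)" for j
      using anc_par[of x j] that child hx by auto
    have "(par x, anc i (par x)) \<in> conn_avoiding T v"
      using child.IH i child.prems(2) eq hx by (metis le_SucI)
    moreover have "x \<noteq> v"
      using child.prems(2)[of "h x"] i hx by (simp add: anc_ge)
    moreover have "par x \<noteq> v"
      using child.prems(2)[of "h (par x)"] i hx eq[of "h (par x)"] by (simp add: anc_ge)
    moreover have "(x, par x) \<in> parcs T" using par_arc child by auto
    ultimately have "(x, par x) \<in> {(a, b). (a, b) \<in> parcs T \<and> a \<noteq> v \<and> b \<noteq> v}" by blast
    then have "(x, anc i (par x)) \<in> conn_avoiding T v"
      using \<open>(par x, anc i (par x)) \<in> _\<close> unfolding conn_avoiding_def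
      by (rule converse_rtrancl_into_rtrancl)
    then show ?thesis using eq i by simp
  qed
qed

text \<open>The subtree of \<open>w\<close> can be left only by stepping from \<open>w\<close> to
  its parent, and that parent is the avoided node.\<close>

lemma conn_avoiding_below:
  assumes "(x, y) \<in> conn_avoiding T v" "x \<in> pverts T"
    and "anc (Suc i) x = w" "h w = Suc i" "par w = v"
  shows "y \<in> pverts T \<and> anc (Suc i) y = w"
  using assms(1) unfolding conn_avoiding_def
proof (induction rule: rtrancl_induct)
  case base
  then show ?case using assms by simp
next
  case (step y z)
  then have y: "y \<in> pverts T" "anc (Suc i) y = w" and arc: "(y, z) \<in> parcs T" "z \<noteq> v" by auto
  have hy: "Suc i \<le> h y"
    using anc_in_height(2)[OF y(1), of "Suc i"] y assms(4) by auto
  from arc(1) consider "z \<in> pverts T" "y \<noteq> r" "z = par y" | "z \<in> pverts T" "z \<noteq> r" "y = par z"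
    unfolding arcs_iff by blast
  then show ?case
  proof cases
    case 1
    have "h y \<noteq> Suc i"
      using y 1 arc(2) assms(5) anc_ge[of y "Suc i"] by auto
    then show ?thesis using anc_par[of y "Suc i"] y hy 1 by auto
  next
    case 2
    then show ?thesis using anc_par[of z "Suc i"] height_par[of z] y hy by auto
  qed
qed

end

section \<open>Rooting an arbitrary tree\<close>

context pair_graph
begin

lemma conn_avoiding_awalk:
  assumes "(a, b) \<in> conn_avoiding G v" "a \<in> pverts G"
  shows "\<exists>p. awalk a p b \<and> set p \<subseteq> {(x, y). x \<noteq> v \<and> y \<noteq> v}"
  using assms(1) unfolding conn_avoiding_def
proof (induction rule: rtrancl_induct)
  case base
  then show ?case using assms(2) by (intro exI[of _ "[]"]) (simp add: awalk_Nil_iff)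
next
  case (step b c)
  then obtain p where p: "awalk a p b" "set p \<subseteq> {(x, y). x \<noteq> v \<and> y \<noteq> v}" by blast
  have "awalk b [(b, c)] c"
    using step(2) wellformed' by (auto simp: awalk_simps)
  then have "awalk a (p @ [(b, c)]) c" using p by auto
  then show ?case using p step(2) by (intro exI[of _ "p @ [(b, c)]"]) auto
qed

text \<open>Otherwise a connection from \<open>a\<close> to \<open>b\<close> closes through
  \<open>v\<close> to a cycle. It is first shortened to a path, as a cycle must not repeat vertices;
  the path has at least one arc, so the cycle has at least three.\<close>

lemma conn_avoiding_neighbours:
  assumes acyclic: "\<And>p. cycle p \<Longrightarrow> length p < 3"
    and arcs: "(v, a) \<in> parcs G" "(v, b) \<in> parcs G" and conn: "(a, b) \<in> conn_avoiding G v"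
  shows "a = b"
proof (rule ccontr)
  assume "a \<noteq> b"
  have ab: "a \<in> pverts G" "b \<in> pverts G" "v \<in> pverts G" "a \<noteq> v" "b \<noteq> v"
    using arcs wellformed' no_loops' by blast+
  obtain p where p: "awalk a p b" "set p \<subseteq> {(x, y). x \<noteq> v \<and> y \<noteq> v}"
    using conn_avoiding_awalk[OF conn ab(1)] by blast
  let ?q = "awalk_to_apath p"
  have q: "apath a ?q b" "set ?q \<subseteq> {(x, y). x \<noteq> v \<and> y \<noteq> v}"
    using p apath_awalk_to_apath awalk_to_apath_subset by blast+
  then have aw: "awalk a ?q b" and dist: "distinct (pawalk_verts a ?q)"
    by (auto simp: apath_def)
  have "v \<notin> set (pawalk_verts a ?q)"
    using set_awalk_verts[OF aw] q(2) ab by auto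
  have ne: "?q \<noteq> []" using aw \<open>a \<noteq> b\<close> by (auto simp: awalk_Nil_iff)
  have bv: "(b, v) \<in> parcs G" using arcs by (auto intro: arcs_symmetric)
  have "awalk a (?q @ [(b, v)]) v"
    using aw bv ab by (auto simp: awalk_simps)
  then have "awalk v ((v, a) # ?q @ [(b, v)]) v"
    using arcs by (auto simp: awalk_Cons_iff)
  moreover have "pawalk_verts a (?q @ [(b, v)]) = pawalk_verts a ?q @ [v]"
    using awalk_verts_append[OF \<open>awalk a (?q @ [(b, v)]) v\<close>] aw by simp
  ultimately have "cycle ((v, a) # ?q @ [(b, v)])"
    using dist \<open>v \<notin> _\<close> by (auto simp: cycle_def intro!: exI[of _ v])
  from acyclic[OF this] show False using ne by (cases ?q) auto
qed

end

text \<open>The parent of \<open>v\<close> is a neighbour one step closer to \<open>r\<close>. What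
  needs acyclicity is that every arc joins a node to its parent.\<close>

lemma is_tree_imp_parent_tree:
  assumes "is_tree T" "r \<in> pverts T"
  shows "\<exists>par. parent_tree T r par (graph_dist T r)"
proof -
  interpret pair_graph T using assms by (simp add: is_tree_def)
  have acyclic: "length p < 3" if "cycle p" for p
    using that assms unfolding is_tree_def by (meson not_less)
  have conn: "(r, v) \<in> (parcs T)\<^sup>*" if "v \<in> pverts T" for v
    using that assms connected_iff_rtrancl by (auto simp: is_tree_def)
  let ?h = "graph_dist T r"
  have walk: "(r, v) \<in> parcs T ^^ ?h v" if "v \<in> pverts T" for v
    using relpow_graph_dist[OF assms(2) conn[OF that]] .
  have arc: "?h v \<le> Suc (?h u)" if "(u, v) \<in> parcs T" for u v
  proof -
    have "(r, v) \<in> parcs T ^^ Suc (?h u)"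
      using walk[of u] that wellformed' by (meson relpow_Suc_I)
    then show ?thesis using graph_dist_le assms(2) by blast
  qed
  have pred: "\<exists>u. (u, v) \<in> parcs T \<and> ?h v = Suc (?h u)" if v: "v \<in> pverts T" "v \<noteq> r" for v
  proof -
    have "?h v \<noteq> 0" using walk[OF v(1)] v(2) by (metis relpow_0_E)
    then obtain n where n: "?h v = Suc n" by (cases "?h v") auto
    then obtain u where u: "(r, u) \<in> parcs T ^^ n" "(u, v) \<in> parcs T"
      using walk[OF v(1)] by auto
    then have "?h u \<le> n" using graph_dist_le assms(2) by blast
    then show ?thesis using u arc[OF u(2)] n by auto
  qed
  \<comment> \<open>On a shortest walk from \<open>r\<close> to \<open>u\<close> all nodes before
    \<open>u\<close> are strictly closer to \<open>r\<close>, so \<open>v\<close> cannot be among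
    them.\<close>
  have below: "(r, u) \<in> conn_avoiding T v" if "u \<in> pverts T" "u \<noteq> v" "?h u \<le> ?h v" for u v
    using that
  proof (induction "?h u" arbitrary: u)
    case 0
    then have "u = r" using walk[of u] by (metis relpow_0_E)
    then show ?case by (simp add: conn_avoiding_def)
  next
    case (Suc n)
    then have "u \<noteq> r" using graph_dist_self[OF assms(2)] by auto
    then obtain w where w: "(w, u) \<in> parcs T" "?h u = Suc (?h w)" using pred Suc by blast
    then have "w \<in> pverts T" "w \<noteq> v" "n = ?h w" "?h w \<le> ?h v"
      using Suc.hyps(2) Suc.prems wellformed'(1)[OF w(1)] by auto
    then have "(r, w) \<in> conn_avoiding T v" using Suc.hyps(1) by blast
    moreover have "(w, u) \<in> {(a, b). (a, b) \<in> parcs T \<and> a \<noteq> v \<and> b \<noteq> v}"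
      using w(1) \<open>u \<noteq> v\<close> \<open>w \<noteq> v\<close> by blast
    ultimately show ?case
      unfolding conn_avoiding_def by (rule rtrancl_into_rtrancl)
  qed
  \<comment> \<open>Both neighbours reach \<open>r\<close> without passing \<open>v\<close>, hence
    reach each other. Admitting equal distance in the hypotheses also rules out arcs between nodes
    of the same level.\<close>
  have unique: "a = b" if "(v, a) \<in> parcs T" "(v, b) \<in> parcs T" "?h a \<le> ?h v" "?h b \<le> ?h v" for v a b
  proof -
    have "a \<in> pverts T" "b \<in> pverts T" "a \<noteq> v" "b \<noteq> v"
      using that wellformed' no_loops' by blast+
    then have "(r, a) \<in> conn_avoiding T v" "(r, b) \<in> conn_avoiding T v"
      using below that by auto
    then have "(a, b) \<in> conn_avoiding T v"
      using conn_avoiding_sym unfolding conn_avoiding_def by (meson rtrancl_trans symE)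
    then show ?thesis using conn_avoiding_neighbours[OF acyclic] that by blast
  qed
  define par where "par v = (SOME u. (u, v) \<in> parcs T \<and> ?h v = Suc (?h u))" for v
  have par: "(par v, v) \<in> parcs T" "?h v = Suc (?h (par v))" if "v \<in> pverts T" "v \<noteq> r" for v
    using someI_ex[OF pred[OF that]] by (auto simp: par_def)
  have up: "v \<noteq> r \<and> u = par v" if "(u, v) \<in> parcs T" "?h u \<le> ?h v" for u v
  proof -
    have uv: "u \<in> pverts T" "v \<in> pverts T" "u \<noteq> v" using that wellformed' no_loops' by blast+
    have "v \<noteq> r"
    proof
      assume "v = r"
      then have "?h u = 0" using that graph_dist_self[OF assms(2)] by simp
      then show False using walk[OF uv(1)] uv \<open>v = r\<close> by (metis relpow_0_E)
    qed
    then show ?thesis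
      using unique[of v u "par v"] par[OF uv(2)] that arcs_symmetric by auto
  qed
  have "parent_tree T r par ?h"
  proof
    show "?h r = 0" using graph_dist_self assms(2) .
  next
    fix u v
    show "(u, v) \<in> parcs T \<longleftrightarrow> u \<in> pverts T \<and> v \<in> pverts T \<and>
        (u \<noteq> r \<and> v = par u \<or> v \<noteq> r \<and> u = par v)"
      using up[of u v] up[of v u] par[of u] par[of v] arcs_symmetric[of u v] arcs_symmetric[of v u]
        wellformed'[of u v] by (meson nle_le)
  qed (use assms par wellformed' in auto)
  then show ?thesis by blast
qed

section \<open>Layerings\<close>

lemma (in parent_tree) children_eq:
  assumes "v \<in> pverts T" "\<And>w. w \<in> pverts T \<Longrightarrow> graph_dist T r w = h w"
  shows "children T r v = {w \<in> pverts T. w \<noteq> r \<and> par w = v}"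
  using assms height_par height_root unfolding children_def
  by (auto simp: arcs_iff)

text \<open>
  In a rooted tree with all leaves \<open>V\<close> at depth \<open>d\<close>, let \<open>A j x\<close> be the ancestor of \<open>x\<close> at
  depth \<open>j\<close>; two leaves \<open>x\<close>, \<open>y\<close> then have distance \<open>2 * gap d A x y\<close>.
\<close>

definition layering :: "'a set \<Rightarrow> nat \<Rightarrow> (nat \<Rightarrow> 'a \<Rightarrow> nat) \<Rightarrow> bool" where
  "layering V d A \<longleftrightarrow> finite V \<and> V \<noteq> {} \<and> (\<forall>x \<in> V. \<forall>y \<in> V. A 0 x = A 0 y) \<and>
     (\<forall>j < d. \<forall>x \<in> V. \<forall>y \<in> V. A (Suc j) x = A (Suc j) y \<longrightarrow> A j x = A j y) \<and> inj_on (A d) V"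

definition gap :: "nat \<Rightarrow> (nat \<Rightarrow> 'a \<Rightarrow> nat) \<Rightarrow> 'a \<Rightarrow> 'a \<Rightarrow> nat" where
  "gap d A x y = card {j. j \<le> d \<and> A j x \<noteq> A j y}"

definition graph_layering ::
    "nat \<Rightarrow> nat \<Rightarrow> 'a pair_pre_digraph \<Rightarrow> (nat \<Rightarrow> 'a \<Rightarrow> nat) \<Rightarrow> ('a \<Rightarrow> nat) \<Rightarrow> bool" where
  "graph_layering k d G A f \<longleftrightarrow> layering (pverts G) d A \<and> (\<forall>x \<in> pverts G. f x \<in> {1..k}) \<and>
     (\<forall>x\<^sub>1 \<in> pverts G. \<forall>y\<^sub>1 \<in> pverts G. \<forall>x\<^sub>2 \<in> pverts G. \<forall>y\<^sub>2 \<in> pverts G.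
        gap d A x\<^sub>1 y\<^sub>1 = gap d A x\<^sub>2 y\<^sub>2 \<and> f x\<^sub>1 = f x\<^sub>2 \<and> f y\<^sub>1 = f y\<^sub>2 \<longrightarrow>
        ((x\<^sub>1, y\<^sub>1) \<in> parcs G \<longleftrightarrow> (x\<^sub>2, y\<^sub>2) \<in> parcs G))"

text \<open>Leaves may lie at different heights: beyond the height of \<open>\<sigma> x\<close> the
  ancestor stays \<open>\<sigma> x\<close>, so layer \<open>d\<close> separates vertices because
  \<open>\<sigma>\<close> does. For shrubberies all heights equal \<open>d\<close>; for
  decompositions the inequality matters.\<close>

lemma layering_ancestors:
  fixes T :: "nat pair_pre_digraph" and \<sigma> :: "'a \<Rightarrow> nat"
  assumes "parent_tree T r par h"
    and "finite V" "V \<noteq> {}" "inj_on \<sigma> V" "\<And>x. x \<in> V \<Longrightarrow> \<sigma> x \<in> pverts T"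
    and "\<And>x. x \<in> V \<Longrightarrow> h (\<sigma> x) \<le> d"
  shows "layering V d (\<lambda>j x. parent_tree.anc par h j (\<sigma> x))"
proof -
  interpret parent_tree T r par h by fact
  show ?thesis
    unfolding layering_def
  proof (intro conjI ballI allI impI)
    fix x y assume "x \<in> V" "y \<in> V"
    then show "anc 0 (\<sigma> x) = anc 0 (\<sigma> y)"
      using anc_in_height[of "\<sigma> x" 0] anc_in_height[of "\<sigma> y" 0] height_eq_0 assms(5)
      by (metis min_0L)
  next
    fix j x y assume "x \<in> V" "y \<in> V" "anc (Suc j) (\<sigma> x) = anc (Suc j) (\<sigma> y)"
    then show "anc j (\<sigma> x) = anc j (\<sigma> y)"
      using anc_anc[of "\<sigma> x" j "Suc j"] anc_anc[of "\<sigma> y" j "Suc j"] assms(5)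
      by (metis le_SucI order_refl)
  next
    have "anc d (\<sigma> x) = \<sigma> x" if "x \<in> V" for x
      using assms(6)[OF that] by (simp add: anc_ge)
    then show "inj_on (\<lambda>x. anc d (\<sigma> x)) V"
      using assms(4) by (simp cong: inj_on_cong)
  qed (use assms(2,3) in auto)
qed

lemma shrubbery_imp_graph_layering:
  fixes T :: "nat pair_pre_digraph"
  assumes sh: "shrubbery k d G T r \<sigma> f" and "finite (pverts G)" "pverts G \<noteq> {}"
  shows "\<exists>A. graph_layering k d G A f"
proof -
  have "is_tree T" "r \<in> pverts T" using sh by (auto simp: shrubbery_def)
  from is_tree_imp_parent_tree[OF this]
  obtain par where "parent_tree T r par (graph_dist T r)" ..
  then interpret parent_tree T r par "graph_dist T r" .
  have \<sigma>: "bij_betw \<sigma> (pverts G) (rooted_leaves T r)" using sh by (simp add: shrubbery_def)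
  have in_T: "\<sigma> x \<in> pverts T" "graph_dist T r (\<sigma> x) = d" if "x \<in> pverts G" for x
    using that sh bij_betwE[OF \<sigma>] by (auto simp: shrubbery_def rooted_leaves_def)
  define A where "A j x = anc j (\<sigma> x)" for j x
  have dist: "graph_dist T (\<sigma> x) (\<sigma> y) = 2 * gap d A x y" if "x \<in> pverts G" "y \<in> pverts G" for x y
    using graph_dist_level[OF in_T(1)[OF that(1)] in_T(1)[OF that(2)] in_T(2)[OF that(1)] in_T(2)[OF that(2)]]
    by (simp add: gap_def A_def)
  have "layering (pverts G) d A"
    unfolding A_def
    using assms(2,3) in_T \<sigma> by (intro layering_ancestors[OF parent_tree_axioms]) (simp_all add: bij_betw_def)
  moreover have "(x\<^sub>1, y\<^sub>1) \<in> parcs G \<longleftrightarrow> (x\<^sub>2, y\<^sub>2) \<in> parcs G"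
    if V: "x\<^sub>1 \<in> pverts G" "y\<^sub>1 \<in> pverts G" "x\<^sub>2 \<in> pverts G" "y\<^sub>2 \<in> pverts G"
      and eq: "gap d A x\<^sub>1 y\<^sub>1 = gap d A x\<^sub>2 y\<^sub>2 \<and> f x\<^sub>1 = f x\<^sub>2 \<and> f y\<^sub>1 = f y\<^sub>2" for x\<^sub>1 y\<^sub>1 x\<^sub>2 y\<^sub>2
  proof -
    have "graph_dist T (\<sigma> x\<^sub>1) (\<sigma> y\<^sub>1) = graph_dist T (\<sigma> x\<^sub>2) (\<sigma> y\<^sub>2)"
      using dist V eq by simp
    then show ?thesis using sh V eq unfolding shrubbery_def by blast
  qed
  ultimately have "graph_layering k d G A f"
    using sh unfolding graph_layering_def shrubbery_def by blast
  then show ?thesis by blast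
qed

section \<open>The tree of a layering\<close>

locale layers =
  fixes V :: "'a set" and d :: nat and A :: "nat \<Rightarrow> 'a \<Rightarrow> nat"
  assumes layering: "layering V d A"
begin

lemma finite_V: "finite V" and V_nonempty: "V \<noteq> {}" and inj_top: "inj_on (A d) V"
  using layering by (auto simp: layering_def)

lemma bottom_eq: "x \<in> V \<Longrightarrow> y \<in> V \<Longrightarrow> A 0 x = A 0 y"
  using layering unfolding layering_def by blast

lemma layer_mono:
  assumes "x \<in> V" "y \<in> V" "i \<le> j" "j \<le> d" "A j x = A j y"
  shows "A i x = A i y"
  using assms(3,4,5)
proof (induction j rule: dec_induct)
  case (step j)
  then have "A j x = A j y"
    using layering assms(1,2) unfolding layering_def by (metis Suc_le_lessD)
  with step show ?case by simp
qed

text \<open>Once two vertices differ they differ on all later levels, so the levels counted by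
  \<open>gap\<close> form a final segment of \<open>{..e}\<close>, determined by its size. The bound
  \<open>e\<close> may be smaller than \<open>d\<close>: it is later the level of the deleted
  node.\<close>

lemma eq_iff_gap:
  assumes "x \<in> V" "y \<in> V" "j \<le> e" "e \<le> d"
  shows "A j x = A j y \<longleftrightarrow> j + gap e A x y \<le> e"
proof
  assume "A j x = A j y"
  moreover have "j \<le> d" using assms by simp
  ultimately have "{i. i \<le> e \<and> A i x \<noteq> A i y} \<subseteq> {j<..e}"
    using layer_mono[OF assms(1,2), of _ j] by (auto simp: not_le[symmetric])
  then have "gap e A x y \<le> card {j<..e}"
    unfolding gap_def by (intro card_mono) auto
  then show "j + gap e A x y \<le> e" using assms(3) by auto
next
  assume le: "j + gap e A x y \<le> e"
  show "A j x = A j y"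
  proof (rule ccontr)
    assume "A j x \<noteq> A j y"
    then have "{j..e} \<subseteq> {i. i \<le> e \<and> A i x \<noteq> A i y}"
      using layer_mono[OF assms(1,2), of j] assms(4) by fastforce
    then have "card {j..e} \<le> gap e A x y"
      unfolding gap_def by (intro card_mono) auto
    then show False using le assms(3) by auto
  qed
qed

text \<open>Values of \<open>A\<close> are compared only within a level, so the level is coded into
  the node. The pairing function keeps nodes natural numbers, the node type that
  \<open>bounded_shrub_depth\<close> and \<open>branch_depth\<close> ask for.\<close>

definition node :: "nat \<Rightarrow> 'a \<Rightarrow> nat" where
  "node j x = prod_encode (j, A j x)"

definition nodes :: "nat set" where
  "nodes = {node j x | j x. j \<le> d \<and> x \<in> V}"

definition root :: nat where
  "root = node 0 (SOME x. x \<in> V)"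

definition height :: "nat \<Rightarrow> nat" where
  "height u = fst (prod_decode u)"

definition parent :: "nat \<Rightarrow> nat" where
  "parent u = node (height u - 1) (SOME x. x \<in> V \<and> node (height u) x = u)"

definition layer_tree :: "nat pair_pre_digraph" where
  "layer_tree = \<lparr>pverts = nodes, parcs = {(u, v). u \<in> nodes \<and> v \<in> nodes \<and>
     (u \<noteq> root \<and> v = parent u \<or> v \<noteq> root \<and> u = parent v)}\<rparr>"

lemma node_eq_iff: "node i x = node j y \<longleftrightarrow> i = j \<and> A i x = A j y"
  by (simp add: node_def)

lemma height_node: "height (node j x) = j"
  by (simp add: height_def node_def)

lemma node_0: "x \<in> V \<Longrightarrow> node 0 x = root"
  unfolding root_def node_eq_iff using bottom_eq someI_ex[of "\<lambda>x. x \<in> V"] by blast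

lemma node_in: "x \<in> V \<Longrightarrow> j \<le> d \<Longrightarrow> node j x \<in> nodes"
  by (auto simp: nodes_def)

lemma nodesE:
  assumes "u \<in> nodes"
  obtains j x where "j \<le> d" "x \<in> V" "u = node j x"
  using assms by (auto simp: nodes_def)

lemma height_root_eq: "height root = 0"
  by (simp add: root_def height_node)

lemma node_Suc_neq_root: "node (Suc j) x \<noteq> root"
  by (metis height_node height_root_eq nat.distinct(1))

lemma nonroot_nodesE:
  assumes "u \<in> nodes" "u \<noteq> root"
  obtains j x where "j < d" "x \<in> V" "u = node (Suc j) x"
proof -
  obtain j x where j: "j \<le> d" "x \<in> V" "u = node j x" using assms(1) by (rule nodesE)
  then have "j \<noteq> 0" using assms(2) node_0 by metis
  then obtain i where "j = Suc i" by (cases j) auto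
  with j show ?thesis using that[of i x] by auto
qed

text \<open>The vertex chosen in \<open>parent\<close> does not matter: vertices that agree on level
  \<open>Suc j\<close> agree on level \<open>j\<close>.\<close>

lemma parent_node:
  assumes "x \<in> V" "j < d"
  shows "parent (node (Suc j) x) = node j x"
proof -
  define y where "y = (SOME y. y \<in> V \<and> node (Suc j) y = node (Suc j) x)"
  have "y \<in> V \<and> node (Suc j) y = node (Suc j) x"
    unfolding y_def by (rule someI[of _ x]) (use assms in auto)
  then have "A j y = A j x"
    using layer_mono[of y x j "Suc j"] assms by (auto simp: node_eq_iff)
  then show ?thesis
    unfolding parent_def height_node y_def[symmetric] by (simp add: node_eq_iff)
qed

lemma parent_tree_layer_tree: "parent_tree layer_tree root parent height"
proof
  have "nodes = (\<lambda>(j, x). node j x) ` ({..d} \<times> V)"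
    by (auto simp: nodes_def)
  then show "finite (pverts layer_tree)"
    using finite_V by (simp add: layer_tree_def)
  show "root \<in> pverts layer_tree"
    using V_nonempty node_0 node_in[of _ 0] by (force simp: layer_tree_def)
  show "height root = 0" by (rule height_root_eq)
next
  fix u assume "u \<in> pverts layer_tree" "u \<noteq> root"
  then obtain j x where u: "j < d" "x \<in> V" "u = node (Suc j) x"
    using nonroot_nodesE by (auto simp: layer_tree_def)
  then show "parent u \<in> pverts layer_tree" "height u = Suc (height (parent u))"
    by (auto simp: parent_node layer_tree_def node_in height_node)
qed (auto simp: layer_tree_def)

sublocale T: parent_tree layer_tree root parent height
  by (rule parent_tree_layer_tree)

lemma pverts_layer_tree: "pverts layer_tree = nodes"
  by (simp add: layer_tree_def)

lemma anc_node:
  assumes "x \<in> V" "j \<le> d"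
  shows "T.anc i (node j x) = node (min i j) x"
  using assms(2)
proof (induction j)
  case 0
  then show ?case by (simp add: T.anc_ge height_node)
next
  case (Suc j)
  show ?case
  proof (cases "i < Suc j")
    case True
    then show ?thesis
      using T.anc_par[of "node (Suc j) x" i] Suc assms(1)
      by (simp add: height_node parent_node pverts_layer_tree node_in)
  next
    case False
    then show ?thesis by (simp add: T.anc_ge height_node)
  qed
qed

lemma children_node:
  assumes "u \<in> nodes"
  shows "{w \<in> nodes. w \<noteq> root \<and> parent w = u} =
    {node (Suc (height u)) x | x. x \<in> V \<and> height u < d \<and> node (height u) x = u}"
proof (intro set_eqI iffI)
  fix w assume "w \<in> {w \<in> nodes. w \<noteq> root \<and> parent w = u}"
  then have w: "w \<in> nodes" "w \<noteq> root" "parent w = u" by auto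
  obtain j x where "j < d" "x \<in> V" "w = node (Suc j) x"
    using w(1,2) by (rule nonroot_nodesE)
  with w(3) show "w \<in> {node (Suc (height u)) x | x. x \<in> V \<and> height u < d \<and> node (height u) x = u}"
    by (auto simp: parent_node height_node)
next
  fix w assume "w \<in> {node (Suc (height u)) x | x. x \<in> V \<and> height u < d \<and> node (height u) x = u}"
  then show "w \<in> {w \<in> nodes. w \<noteq> root \<and> parent w = u}"
    by (auto simp: parent_node node_in node_Suc_neq_root)
qed

lemma bij_betw_top: "bij_betw (node d) V {u \<in> nodes. height u = d}"
proof -
  have "inj_on (node d) V"
    using inj_top by (auto simp: inj_on_def node_eq_iff)
  moreover have "node d ` V = {u \<in> nodes. height u = d}"
  proof (intro set_eqI iffI)
    fix u assume u: "u \<in> {u \<in> nodes. height u = d}"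
    then have "u \<in> nodes" by simp
    then obtain j x where "j \<le> d" "x \<in> V" "u = node j x" by (rule nodesE)
    with u show "u \<in> node d ` V" by (auto simp: height_node)
  qed (auto simp: node_in height_node)
  ultimately show ?thesis by (simp add: bij_betw_def)
qed

text \<open>Each node has the form \<open>node j x\<close>, and for \<open>j < d\<close> the same
  \<open>x\<close> provides the child \<open>node (Suc j) x\<close>. So all branches end exactly at
  level \<open>d\<close>.\<close>

lemma rooted_leaves_layer_tree: "rooted_leaves layer_tree root = {u \<in> nodes. height u = d}"
proof -
  have "children layer_tree root u = {} \<longleftrightarrow> height u = d" if u: "u \<in> nodes" for u
  proof -
    obtain j x where j: "j \<le> d" "x \<in> V" "u = node j x" using u by (rule nodesE)
    have "children layer_tree root u = {w \<in> nodes. w \<noteq> root \<and> parent w = u}"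
      using T.children_eq[of u] u T.graph_dist_root by (simp add: pverts_layer_tree)
    also have "\<dots> = {node (Suc (height u)) x | x. x \<in> V \<and> height u < d \<and> node (height u) x = u}"
      using children_node[OF u] .
    finally show ?thesis using j by (auto simp: height_node)
  qed
  then show ?thesis by (auto simp: rooted_leaves_def pverts_layer_tree)
qed

lemma graph_dist_top:
  assumes "x \<in> V" "y \<in> V"
  shows "graph_dist layer_tree (node d x) (node d y) = 2 * gap d A x y"
proof -
  have "{j. j \<le> d \<and> T.anc j (node d x) \<noteq> T.anc j (node d y)} = {j. j \<le> d \<and> A j x \<noteq> A j y}"
    using assms by (auto simp: anc_node min_absorb1 node_eq_iff)
  then show ?thesis
    using T.graph_dist_level[of "node d x" "node d y" d] assms
    by (simp add: gap_def pverts_layer_tree node_in height_node)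
qed

end

lemma graph_layering_imp_shrubbery:
  assumes "graph_layering k d G A f"
  shows "\<exists>(T :: nat pair_pre_digraph) r \<sigma>. shrubbery k d G T r \<sigma> f"
proof -
  interpret layers "pverts G" d A
    using assms by (simp add: layers_def graph_layering_def)
  have "shrubbery k d G layer_tree root (node d) f"
    unfolding shrubbery_def
  proof (intro conjI ballI impI)
    show "is_tree layer_tree" by (rule T.is_tree_T)
    show "root \<in> pverts layer_tree" by (rule T.root_in)
    show "bij_betw (node d) (pverts G) (rooted_leaves layer_tree root)"
      using bij_betw_top rooted_leaves_layer_tree by simp
  next
    fix x assume "x \<in> pverts G"
    then show "graph_dist layer_tree root (node d x) = d"
      by (simp add: T.graph_dist_root pverts_layer_tree node_in height_node)
  next
    fix x assume "x \<in> pverts G"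
    then show "f x \<in> {1..k}" using assms by (simp add: graph_layering_def)
  next
    fix x\<^sub>1 y\<^sub>1 x\<^sub>2 y\<^sub>2
    assume V: "x\<^sub>1 \<in> pverts G" "y\<^sub>1 \<in> pverts G" "x\<^sub>2 \<in> pverts G" "y\<^sub>2 \<in> pverts G"
      and eq: "graph_dist layer_tree (node d x\<^sub>1) (node d y\<^sub>1) = graph_dist layer_tree (node d x\<^sub>2) (node d y\<^sub>2) \<and>
        f x\<^sub>1 = f x\<^sub>2 \<and> f y\<^sub>1 = f y\<^sub>2"
    then have "gap d A x\<^sub>1 y\<^sub>1 = gap d A x\<^sub>2 y\<^sub>2"
      using graph_dist_top by simp
    then show "(x\<^sub>1, y\<^sub>1) \<in> parcs G \<longleftrightarrow> (x\<^sub>2, y\<^sub>2) \<in> parcs G"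
      using assms V eq unfolding graph_layering_def by blast
  qed
  then show ?thesis by blast
qed

section \<open>Types across a partition\<close>

text \<open>With two scalars, adjoining a generator at most doubles the span.\<close>

lemma card_span_bit:
  fixes B :: "('a \<Rightarrow> bit) set"
  assumes "finite B"
  shows "finite (bit_fun.span B) \<and> card (bit_fun.span B) \<le> 2 ^ card B"
  using assms
proof (induction B)
  case empty
  show ?case unfolding bit_fun.span_empty by simp
next
  case (insert a B)
  let ?f = "\<lambda>(k :: bit, y). y + (\<lambda>j. k * a j)"
  have bits: "(UNIV :: bit set) = {0, 1}" by (auto simp: bit_not_one_iff)
  have sub: "bit_fun.span (insert a B) \<subseteq> ?f ` (UNIV \<times> bit_fun.span B)"
  proof
    fix x assume "x \<in> bit_fun.span (insert a B)"
    then obtain k where "x - (\<lambda>j. k * a j) \<in> bit_fun.span B"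
      unfolding bit_fun.span_insert by blast
    then show "x \<in> ?f ` (UNIV \<times> bit_fun.span B)"
      by (intro image_eqI[of _ _ "(k, x - (\<lambda>j. k * a j))"]) auto
  qed
  have fin: "finite ((UNIV :: bit set) \<times> bit_fun.span B)"
    using insert by (intro finite_cartesian_product) (simp_all add: bits)
  have "card (?f ` (UNIV \<times> bit_fun.span B)) \<le> card ((UNIV :: bit set) \<times> bit_fun.span B)"
    using fin by (rule card_image_le)
  also have "\<dots> = 2 * card (bit_fun.span B)"
    by (simp add: card_cartesian_product bits)
  also have "\<dots> \<le> 2 ^ card (insert a B)"
    using insert by simp
  finally show ?case
    using sub fin card_mono[OF _ sub] finite_subset[OF sub] by (meson finite_imageI le_trans)
qed

text \<open>The rows lie in the span of a basis of size \<open>bit_fun.dim S\<close>. From here on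
  the rank enters only through the number of distinct rows.\<close>

lemma card_le_two_power_dim:
  fixes S :: "('a \<Rightarrow> bit) set"
  assumes "finite S"
  shows "card S \<le> 2 ^ bit_fun.dim S"
proof -
  obtain B where B: "B \<subseteq> S" "S \<subseteq> bit_fun.span B" "card B = bit_fun.dim S"
    using bit_fun.basis_exists by metis
  then have "finite B" using assms finite_subset by blast
  then show ?thesis
    using card_span_bit[of B] B card_mono[of "bit_fun.span B" S] by auto
qed

lemma dim_le_card_rows:
  fixes S :: "('a \<Rightarrow> bit) set"
  shows "finite S \<Longrightarrow> bit_fun.dim S \<le> card S"
  using bit_fun.dim_le_card[OF bit_fun.span_superset] .

lemma ex_nat_labels:
  assumes "finite V" "card (t ` V) \<le> N"
  shows "\<exists>g :: 'a \<Rightarrow> nat. (\<forall>x \<in> V. g x < N) \<and> (\<forall>x \<in> V. \<forall>y \<in> V. g x = g y \<longrightarrow> t x = t y)"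
proof -
  obtain e where e: "bij_betw e (t ` V) {0..<card (t ` V)}"
    using ex_bij_betw_finite_nat[of "t ` V"] assms by blast
  show ?thesis
  proof (intro exI[of _ "\<lambda>x. e (t x)"] conjI ballI impI)
    fix x assume "x \<in> V"
    then show "e (t x) < N" using bij_betwE[OF e] assms(2) by fastforce
  next
    fix x y assume "x \<in> V" "y \<in> V" "e (t x) = e (t y)"
    then show "t x = t y" using e by (auto simp: bij_betw_def inj_on_def)
  qed
qed

lemma card_Pair_image_le:
  assumes "finite V"
  shows "card ((\<lambda>x. (f x, g x)) ` V) \<le> card (f ` V) * card (g ` V)"
proof -
  have "card ((\<lambda>x. (f x, g x)) ` V) \<le> card (f ` V \<times> g ` V)"
    using assms by (intro card_mono) auto
  then show ?thesis by (simp add: card_cartesian_product)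
qed

lemma card_restrict_image_le:
  assumes "finite V" "finite I" "\<And>i. i \<in> I \<Longrightarrow> card (g i ` V) \<le> n"
  shows "card ((\<lambda>x. restrict (\<lambda>i. g i x) I) ` V) \<le> n ^ card I"
proof -
  have "card ((\<lambda>x. restrict (\<lambda>i. g i x) I) ` V) \<le> card (PiE I (\<lambda>i. g i ` V))"
    using assms by (intro card_mono finite_PiE) auto
  also have "\<dots> = (\<Prod>i\<in>I. card (g i ` V))"
    using assms by (simp add: card_PiE)
  also have "\<dots> \<le> (\<Prod>i\<in>I. n)"
    using assms by (intro prod_mono) auto
  finally show ?thesis by simp
qed

section \<open>Finitely many types decide adjacency between parts\<close>

definition rows_across :: "'a set \<Rightarrow> ('a \<Rightarrow> 'a \<Rightarrow> bool) \<Rightarrow> ('a \<Rightarrow> 'b) \<Rightarrow> 'b set \<Rightarrow> 'a \<Rightarrow> 'a set" where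
  "rows_across V M p B x = {y \<in> V. p y \<notin> B \<and> M x y}"

text \<open>At most \<open>K\<close> representatives and \<open>K * K\<close> separating columns
  meet at most \<open>K + K * K\<close> parts. For each such part a vertex shows at most
  \<open>2 * K\<close> rows, \<open>K\<close> on either side; the added 1 keeps the base positive,
  so that the power is monotone in its exponent. The factor \<open>2 ^ (K + K * K)\<close> counts
  adjacency patterns to the representatives and columns.\<close>

definition side_bound :: "nat \<Rightarrow> nat" where
  "side_bound K = (2 * K + 1) ^ (K + K * K) * 2 ^ (K + K * K)"

text \<open>
  A bipartition \<open>B\<close> of the parts with the maximum number of distinct rows stays maximal when parts
  not meeting its representatives \<open>X\<close> and separating columns \<open>Y\<close> are moved from one side to the
  other. Hence a row outside the finitely many parts met by \<open>X \<union> Y\<close> is determined by its entries in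
  \<open>Y\<close>; the parts met by \<open>X \<union> Y\<close> are treated one at a time.
\<close>

lemma bounded_types_across_parts:
  fixes p :: "'a \<Rightarrow> 'b"
  assumes fin: "finite V" and sym: "\<And>x y. M x y \<longleftrightarrow> M y x"
    and rows: "\<And>B. card (rows_across V M p B ` {x \<in> V. p x \<in> B}) \<le> K"
  shows "\<exists>g :: 'a \<Rightarrow> nat. (\<forall>x \<in> V. g x < side_bound K) \<and>
    (\<forall>x \<in> V. \<forall>y \<in> V. \<forall>x' \<in> V. \<forall>y' \<in> V. p x \<noteq> p y \<longrightarrow> p x' \<noteq> p y' \<longrightarrow> g x = g x' \<longrightarrow> g y = g y' \<longrightarrow>
       M x y = M x' y')"
proof -
  let ?R = "rows_across V M p"
  let ?S = "\<lambda>B. {x \<in> V. p x \<in> B}"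
  \<comment> \<open>The counts are bounded by \<open>K\<close>, so a maximum exists although there
    may be infinitely many \<open>B\<close>; \<open>undefined\<close> only witnesses that there is
    some \<open>B\<close>.\<close>
  obtain B where B: "\<And>B'. card (?R B' ` ?S B') \<le> card (?R B ` ?S B)"
    using ex_has_greatest_nat[of "\<lambda>_. True" undefined "\<lambda>B. card (?R B ` ?S B)" "Suc K"] rows
    by (auto simp: less_Suc_eq_le)
  obtain X where X: "X \<subseteq> ?S B" "inj_on (?R B) X" "?R B ` ?S B = ?R B ` X"
    using subset_image_inj[of "?R B ` ?S B" "?R B" "?S B"] by auto
  have finX: "finite X" using X(1) fin by (auto intro: finite_subset)
  have cardX: "card X = card (?R B ` ?S B)" using X card_image by metis
  have "\<exists>y. y \<in> V \<and> p y \<notin> B \<and> M a y \<noteq> M b y" if "a \<in> X" "b \<in> X" "a \<noteq> b" for a b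
  proof -
    have "?R B a \<noteq> ?R B b" using X(2) that by (auto simp: inj_on_def)
    then show ?thesis by (auto simp: rows_across_def)
  qed
  then obtain w where w: "\<And>a b. a \<in> X \<Longrightarrow> b \<in> X \<Longrightarrow> a \<noteq> b \<Longrightarrow>
      w a b \<in> V \<and> p (w a b) \<notin> B \<and> M a (w a b) \<noteq> M b (w a b)"
    by metis
  define Y where "Y = (\<lambda>(a, b). w a b) ` {(a, b) \<in> X \<times> X. a \<noteq> b}"
  have "card Y \<le> card {(a, b) \<in> X \<times> X. a \<noteq> b}"
    unfolding Y_def using finX by (intro card_image_le) (auto intro: finite_subset[of _ "X \<times> X"])
  also have "\<dots> \<le> card (X \<times> X)"
    using finX by (intro card_mono) auto
  finally have cardY: "card Y \<le> K * K"
    using rows[of B] cardX by (simp add: card_cartesian_product) (meson le_trans mult_le_mono)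
  have finY: "finite Y"
    unfolding Y_def using finX by (intro finite_imageI) (auto intro: finite_subset[of _ "X \<times> X"])
  define F where "F = X \<union> Y"
  define Q where "Q = p ` F"
  have finF: "finite F" "finite Q" using finX finY by (auto simp: F_def Q_def)
  have cardF: "card F \<le> K + K * K"
    using card_Un_le[of X Y] cardX cardY rows[of B] by (simp add: F_def)
  then have cardQ: "card Q \<le> K + K * K"
    using card_image_le[of F p] finF by (simp add: Q_def)
  \<comment> \<open>The row of \<open>z\<close> across the bipartition of part \<open>q\<close>
    against all others, tagged with the side of \<open>z\<close>.\<close>
  define c where "c q z = (p z = q, {y \<in> V. (p y = q) \<noteq> (p z = q) \<and> M z y})" for q z
  define t where "t z = (restrict (\<lambda>q. c q z) Q, {v \<in> F. M z v})" for z

  have "card (c q ` V) \<le> 2 * K + 1" for q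
  proof -
    have "c q ` V \<subseteq> Pair True ` ?R {q} ` ?S {q} \<union> Pair False ` ?R (- {q}) ` ?S (- {q})" (is "_ \<subseteq> ?A \<union> ?B")
      by (auto simp: c_def rows_across_def image_iff)
    then have "card (c q ` V) \<le> card ?A + card ?B"
      using fin card_Un_le[of ?A ?B] card_mono[of "?A \<union> ?B" "c q ` V"] by auto
    moreover have "card ?A \<le> K" "card ?B \<le> K"
      using rows[of "{q}"] rows[of "- {q}"] by (simp_all add: card_image inj_on_def)
    ultimately show ?thesis by simp
  qed
  then have 1: "card ((\<lambda>z. restrict (\<lambda>q. c q z) Q) ` V) \<le> (2 * K + 1) ^ (K + K * K)"
    using card_restrict_image_le[OF fin finF(2), of c "2 * K + 1"]
      power_increasing[OF cardQ, of "2 * K + 1"] by (meson le_add2 le_trans)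
  have "card ((\<lambda>z. {v \<in> F. M z v}) ` V) \<le> card (Pow F)"
    using finF by (intro card_mono) auto
  also have "\<dots> \<le> 2 ^ (K + K * K)"
    using finF cardF by (simp add: card_Pow)
  finally have "card (t ` V) \<le> side_bound K"
    unfolding t_def side_bound_def
    using card_Pair_image_le[OF fin, of "\<lambda>z. restrict (\<lambda>q. c q z) Q" "\<lambda>z. {v \<in> F. M z v}"] 1
    by (meson le_trans mult_le_mono)

  have rep: "\<exists>a \<in> X. \<forall>y \<in> V. y \<in> Y \<or> p y \<notin> Q \<and> p y \<noteq> p x \<longrightarrow> M x y = M a y"
    if x: "x \<in> V" "p x \<notin> Q" for x
  proof -
    \<comment> \<open>The parts of \<open>X\<close> remain inside and those of \<open>Y\<close>
      outside, so \<open>X\<close> still has pairwise distinct rows and, by maximality, shows every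
      row of \<open>?B\<close>. As little else as possible is put inside, so that every part outside
      \<open>Q\<close> other than \<open>p x\<close> lies across.\<close>
    let ?B = "insert (p x) (Q \<inter> B)"
    have YB: "p y \<notin> ?B" if "y \<in> Y" for y
    proof -
      have "p y \<in> Q" using that by (auto simp: Q_def F_def)
      moreover have "p y \<notin> B" using that w by (auto simp: Y_def)
      ultimately show ?thesis using x by auto
    qed
    have XS: "X \<subseteq> ?S ?B" using X(1) by (auto simp: Q_def F_def)
    have "inj_on (?R ?B) X"
    proof (rule inj_onI, rule ccontr)
      fix a b assume ab: "a \<in> X" "b \<in> X" "?R ?B a = ?R ?B b" "a \<noteq> b"
      then have "w a b \<in> Y" by (auto simp: Y_def)
      then have "w a b \<in> ?R ?B a \<longleftrightarrow> w a b \<notin> ?R ?B b"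
        using YB w[of a b] ab by (auto simp: rows_across_def)
      then show False using ab by simp
    qed
    then have "card (?R ?B ` X) = card X" by (rule card_image)
    then have "card (?R ?B ` ?S ?B) \<le> card (?R ?B ` X)" using B[of ?B] cardX by simp
    then have "?R ?B ` X = ?R ?B ` ?S ?B"
      using XS fin by (intro card_seteq) auto
    moreover have "x \<in> ?S ?B" using x by simp
    ultimately obtain a where a: "a \<in> X" "?R ?B x = ?R ?B a" by (metis (no_types, lifting) imageE imageI)
    have "M x y = M a y" if "y \<in> V" "y \<in> Y \<or> p y \<notin> Q \<and> p y \<noteq> p x" for y
    proof -
      have "p y \<notin> ?B" using that YB by blast
      then have "y \<in> ?R ?B x \<longleftrightarrow> M x y" "y \<in> ?R ?B a \<longleftrightarrow> M a y"
        using that by (auto simp: rows_across_def)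
      then show ?thesis using a by simp
    qed
    with a show ?thesis by blast
  qed

  \<comment> \<open>One endpoint is exchanged at a time: the row of \<open>x\<close> leaving its
    part gives \<open>M x y = M x' y\<close>, the row of \<open>y\<close> into that part gives
    \<open>M y x' = M y' x'\<close>. Both rows are recorded in \<open>c (p x)\<close>.\<close>
  have one_part: "M x y = M x' y'"
    if V: "x \<in> V" "y \<in> V" "x' \<in> V" "y' \<in> V" and px: "p x \<in> Q" and ne: "p x \<noteq> p y" "p x' \<noteq> p y'"
      and t: "t x = t x'" "t y = t y'" for x y x' y'
  proof -
    have c: "c (p x) x = c (p x) x'" "c (p x) y = c (p x) y'"
      using t px by (auto simp: t_def dest!: fun_cong[of _ _ "p x"])
    then have px': "p x' = p x" and
      rx: "{y \<in> V. p y \<noteq> p x \<and> M x y} = {y \<in> V. p y \<noteq> p x \<and> M x' y}"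
      by (auto simp: c_def)
    have ry: "{z \<in> V. p z = p x \<and> M y z} = {z \<in> V. p z = p x \<and> M y' z}"
      using c(2) ne px' by (auto simp: c_def)
    have "M x y = M x' y"
      using arg_cong[OF rx, of "\<lambda>S. y \<in> S"] V(2) ne(1) by simp
    moreover have "M y x' = M y' x'"
      using arg_cong[OF ry, of "\<lambda>S. x' \<in> S"] V(3) px' by simp
    ultimately show ?thesis using sym by blast
  qed

  have determined: "M x y = M x' y'"
    if V: "x \<in> V" "y \<in> V" "x' \<in> V" "y' \<in> V" and ne: "p x \<noteq> p y" "p x' \<noteq> p y'"
      and t: "t x = t x'" "t y = t y'" for x y x' y'
  proof (cases "p x \<in> Q \<or> p y \<in> Q")
    case True
    then show ?thesis using one_part[OF V] one_part[OF V(2,1,4,3)] ne t sym by metis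
  next
    case False
    have F: "M x v = M x' v" "M y v = M y' v" if "v \<in> F" for v
      using t that by (auto simp: t_def)
    have nQ: "p x' \<notin> Q" "p y' \<notin> Q"
    proof -
      have "p z \<in> Q \<Longrightarrow> t z = t z' \<Longrightarrow> p z' = p z" for z z'
        by (auto simp: t_def c_def dest!: fun_cong[of _ _ "p z"])
      then show "p x' \<notin> Q" "p y' \<notin> Q" using t False by metis+
    qed
    \<comment> \<open>The representatives of \<open>x\<close> and \<open>x'\<close> agree on
      \<open>Y\<close>, since \<open>t\<close> records adjacency to \<open>F\<close>; as
      \<open>Y\<close> separates \<open>X\<close> they coincide. The common representative lies in
      \<open>F\<close>, so \<open>y\<close> and \<open>y'\<close> have the same adjacency to
      it.\<close>
    obtain a where a: "a \<in> X" "\<And>y. y \<in> V \<Longrightarrow> y \<in> Y \<or> p y \<notin> Q \<and> p y \<noteq> p x \<Longrightarrow> M x y = M a y"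
      using rep[OF V(1)] False by blast
    obtain a' where a': "a' \<in> X" "\<And>y. y \<in> V \<Longrightarrow> y \<in> Y \<or> p y \<notin> Q \<and> p y \<noteq> p x' \<Longrightarrow> M x' y = M a' y"
      using rep[OF V(3) nQ(1)] by blast
    have "a = a'"
    proof (rule ccontr)
      assume "a \<noteq> a'"
      then have "w a a' \<in> Y" "w a a' \<in> V" "M a (w a a') \<noteq> M a' (w a a')"
        using w[OF a(1) a'(1)] a(1) a'(1) by (auto simp: Y_def)
      then show False using a(2) a'(2) F(1)[of "w a a'"] by (auto simp: F_def)
    qed
    moreover have "M x y = M a y" using a(2) V False ne by metis
    moreover have "M x' y' = M a' y'" using a'(2) V nQ ne by metis
    moreover have "M y a = M y' a" using F(2) a(1) by (auto simp: F_def)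
    ultimately show ?thesis using sym by metis
  qed
  obtain g :: "'a \<Rightarrow> nat" where g: "\<forall>x \<in> V. g x < side_bound K"
      "\<forall>x \<in> V. \<forall>y \<in> V. g x = g y \<longrightarrow> t x = t y"
    using ex_nat_labels[OF fin \<open>card (t ` V) \<le> side_bound K\<close>] by auto
  show ?thesis
  proof (intro exI[of _ g] conjI g(1) ballI impI)
    fix x y x' y'
    assume V: "x \<in> V" "y \<in> V" "x' \<in> V" "y' \<in> V" and ne: "p x \<noteq> p y" "p x' \<noteq> p y'"
      and "g x = g x'" "g y = g y'"
    then have "t x = t x'" "t y = t y'" using g(2) by blast+
    with V ne show "M x y = M x' y'" by (rule determined)
  qed
qed

section \<open>From layerings to decompositions\<close>

lemma card_image_le_if_determined:
  assumes "finite X" "\<And>x y. x \<in> X \<Longrightarrow> y \<in> X \<Longrightarrow> t x = t y \<Longrightarrow> g x = g y"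
  shows "card (g ` X) \<le> card (t ` X)"
proof -
  define s where "s \<tau> = (SOME x. x \<in> X \<and> t x = \<tau>)" for \<tau>
  have "s (t x) \<in> X \<and> t (s (t x)) = t x" if "x \<in> X" for x
    unfolding s_def by (rule someI[of _ x]) (use that in auto)
  then have "g x = g (s (t x))" if "x \<in> X" for x
    using assms(2) that by metis
  then have "g ` X = (\<lambda>\<tau>. g (s \<tau>)) ` t ` X"
    by (force simp: image_image)
  then show ?thesis using assms(1) by (simp add: card_image_le)
qed

lemma (in pair_graph) decomposition_width_le_iff:
  assumes "internal_nodes G \<noteq> {}"
  shows "decomposition_width E l G \<sigma> \<le> k \<longleftrightarrow>
    (\<forall>v \<in> internal_nodes G. \<forall>P \<subseteq> node_partition E G \<sigma> v. l (\<Union>P) \<le> k)"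
proof -
  have "node_width E l G \<sigma> v \<le> k \<longleftrightarrow> (\<forall>P \<subseteq> node_partition E G \<sigma> v. l (\<Union>P) \<le> k)" for v
  proof -
    have "finite (node_partition E G \<sigma> v)"
      unfolding node_partition_def sccs_verts_del_vert using pair_finite_verts by simp
    then have "finite {l (\<Union>P) | P. P \<subseteq> node_partition E G \<sigma> v}" by simp
    then show ?thesis
      unfolding node_width_def by (subst Max_le_iff) auto
  qed
  moreover have "finite (internal_nodes G)"
    using pair_finite_verts by (simp add: internal_nodes_def)
  ultimately show ?thesis
    unfolding decomposition_width_def using assms by simp
qed

lemma (in parent_tree) neighbours_eq:
  assumes "v \<in> pverts T"
  shows "{w. (v, w) \<in> parcs T} =
    {w \<in> pverts T. w \<noteq> r \<and> par w = v} \<union> (if v = r then {} else {par v})"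
proof (rule set_eqI)
  fix w
  have "(v, w) \<in> parcs T \<longleftrightarrow> (w \<in> pverts T \<and> w \<noteq> r \<and> par w = v) \<or> (v \<noteq> r \<and> w = par v)"
    unfolding arcs_iff using assms par_in[OF assms] by blast
  moreover have "w \<in> (if v = r then {} else {par v}) \<longleftrightarrow> v \<noteq> r \<and> w = par v" by simp
  ultimately show "w \<in> {w. (v, w) \<in> parcs T} \<longleftrightarrow>
      w \<in> {w \<in> pverts T. w \<noteq> r \<and> par w = v} \<union> (if v = r then {} else {par v})"
    unfolding Un_iff mem_Collect_eq by (simp only:)
qed

lemma (in parent_tree) par_neq_child:
  assumes "v \<in> pverts T" "v \<noteq> r" "w \<in> pverts T" "w \<noteq> r" "par w = v"
  shows "par v \<noteq> w"
proof
  assume "par v = w"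
  then have "h v = Suc (h w)" "h w = Suc (h v)"
    using height_par[OF assms(1,2)] height_par[OF assms(3,4)] assms(5) by simp_all
  then show False by simp
qed

section \<open>The tree of a layering as a decomposition\<close>

lemma gap_comm: "gap d A x y = gap d A y x"
  by (simp add: gap_def eq_commute)

lemma gap_le: "gap e A x y \<le> Suc e"
proof -
  have "gap e A x y \<le> card {..e}"
    unfolding gap_def by (intro card_mono) auto
  then show ?thesis by simp
qed

text \<open>A root with only one child would have degree one and count as a leaf, although no vertex
  is mapped to it.\<close>

locale branching_layers = layers +
  assumes d_pos: "0 < d" and branching: "\<exists>x \<in> V. \<exists>y \<in> V. A 1 x \<noteq> A 1 y"
begin

text \<open>Between root and top level a node has its parent and at least one child; the root has
  two children by \<open>branching\<close>. A top node has only its parent, which exists since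
  \<open>0 < d\<close>.\<close>

lemma out_degree_layer_tree:
  assumes "u \<in> nodes"
  shows "height u = d \<Longrightarrow> out_degree (with_proj layer_tree) u = 1"
    and "height u \<noteq> d \<Longrightarrow> 2 \<le> out_degree (with_proj layer_tree) u"
proof -
  let ?N = "{w. (u, w) \<in> parcs layer_tree}"
  let ?C = "{node (Suc (height u)) x | x. x \<in> V \<and> height u < d \<and> node (height u) x = u}"
  have N: "?N = ?C \<union> (if u = root then {} else {parent u})"
    using T.neighbours_eq[of u] children_node[OF assms] assms by (simp add: pverts_layer_tree)
  have fin: "finite ?N"
    using T.pair_finite_verts T.wellformed'(2) by (auto intro: finite_subset[of _ "pverts layer_tree"])
  obtain j x where u: "j \<le> d" "x \<in> V" "u = node j x" using assms by (rule nodesE)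
  show "out_degree (with_proj layer_tree) u = 1" if "height u = d"
  proof -
    have "u \<noteq> root" using that d_pos height_root_eq by auto
    then have "?N = {parent u}" using N that by auto
    then show ?thesis by (simp add: T.out_degree_eq_card)
  qed
  show "2 \<le> out_degree (with_proj layer_tree) u" if "height u \<noteq> d"
  proof -
    have j: "j < d" using that u by (simp add: height_node)
    have "\<exists>a b. a \<noteq> b \<and> {a, b} \<subseteq> ?N"
    proof (cases "u = root")
      case True
      obtain y z where yz: "y \<in> V" "z \<in> V" "A 1 y \<noteq> A 1 z" using branching by auto
      have "node 1 y \<in> ?C" "node 1 z \<in> ?C"
        using yz(1,2) True d_pos height_root_eq node_0 by auto
      moreover have "node 1 y \<noteq> node 1 z" using yz(3) by (simp add: node_eq_iff)
      ultimately show ?thesis using N by (intro exI[of _ "node 1 y"] exI[of _ "node 1 z"]) auto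
    next
      case False
      have c: "node (Suc j) x \<in> nodes" "node (Suc j) x \<noteq> root" "parent (node (Suc j) x) = u"
        using u j by (simp_all add: node_in node_Suc_neq_root parent_node)
      then have "parent u \<noteq> node (Suc j) x"
        using T.par_neq_child[of u "node (Suc j) x"] False assms by (simp add: pverts_layer_tree)
      moreover have "node (Suc j) x \<in> ?C" using u j by (auto simp: height_node)
      ultimately show ?thesis using N False by (intro exI[of _ "parent u"] exI[of _ "node (Suc j) x"]) auto
    qed
    then obtain a b where "a \<noteq> b" "{a, b} \<subseteq> ?N" by blast
    then have "card {a, b} \<le> card ?N" "card {a, b} = 2"
      using fin by (simp_all only: card_mono) simp
    then show ?thesis unfolding T.out_degree_eq_card by linarith
  qed
qed

lemma leaves_layer_tree: "leaves layer_tree = {u \<in> nodes. height u = d}"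
proof -
  have "out_degree (with_proj layer_tree) u = 1 \<longleftrightarrow> height u = d" if "u \<in> nodes" for u
    using out_degree_layer_tree[OF that] by (cases "height u = d") auto
  then show ?thesis by (auto simp: leaves_def pverts_layer_tree)
qed

lemma internal_nodes_layer_tree: "internal_nodes layer_tree = {u \<in> nodes. height u < d}"
proof -
  have "2 \<le> out_degree (with_proj layer_tree) u \<longleftrightarrow> height u < d" if u: "u \<in> nodes" for u
  proof -
    have "height u \<le> d" using nodesE[OF u] height_node by metis
    then show ?thesis using out_degree_layer_tree[OF u] by (cases "height u = d") auto
  qed
  then show ?thesis by (auto simp: internal_nodes_def pverts_layer_tree)
qed

lemma decomposition_layer_tree: "decomposition V layer_tree (node d)"
proof -
  have "root \<in> internal_nodes layer_tree"
    using T.root_in d_pos by (simp add: internal_nodes_layer_tree pverts_layer_tree height_root_eq)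
  then show ?thesis
    unfolding decomposition_def leaves_layer_tree using T.is_tree_T bij_betw_top by auto
qed

lemma radius_layer_tree: "radius layer_tree \<le> d"
proof -
  have "\<forall>v \<in> pverts layer_tree. graph_dist layer_tree root v \<le> d"
  proof
    fix v assume v: "v \<in> pverts layer_tree"
    then have "v \<in> nodes" by (simp add: pverts_layer_tree)
    then have "height v \<le> d" using nodesE height_node by metis
    then show "graph_dist layer_tree root v \<le> d" using T.graph_dist_root[OF v] by simp
  qed
  then show ?thesis
    unfolding radius_def using T.root_in by (intro Least_le) auto
qed

lemma connected_above:
  assumes "x \<in> V" "y \<in> V" "c \<le> d" "A c x = A c y"
    and "\<And>j. c \<le> j \<Longrightarrow> j \<le> d \<Longrightarrow> node j x \<noteq> v" "\<And>j. c \<le> j \<Longrightarrow> j \<le> d \<Longrightarrow> node j y \<noteq> v"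
  shows "(node d x, node d y) \<in> conn_avoiding layer_tree v"
proof -
  have *: "(node d x, node c x) \<in> conn_avoiding layer_tree v"
    if "x \<in> V" "\<And>j. c \<le> j \<Longrightarrow> j \<le> d \<Longrightarrow> node j x \<noteq> v" for x
    using T.conn_avoiding_anc[of "node d x" c v] that assms(3)
    by (simp add: anc_node pverts_layer_tree node_in height_node min_absorb1)
  have "node c x = node c y" using assms by (simp add: node_eq_iff)
  then have "(node d x, node c x) \<in> conn_avoiding layer_tree v"
    "(node d y, node c x) \<in> conn_avoiding layer_tree v"
    using *[of x] *[of y] assms by auto
  then show ?thesis
    using T.conn_avoiding_sym unfolding conn_avoiding_def by (meson rtrancl_trans symE)
qed

text \<open>The deleted node lies on the path from \<open>x\<close> to \<open>y\<close>, so one of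
  the two branches splits from its ancestor chain exactly where they split from each other: the one
  that leaves the chain closer to the root. If both leave at the same level before reaching the
  node, they are joined below it, contrary to \<open>disc\<close>; if both pass through it, they
  must continue to different children.\<close>

lemma gap_disconnected:
  assumes V: "x \<in> V" "y \<in> V" "z \<in> V" and i: "i < d"
    and disc: "(node d x, node d y) \<notin> conn_avoiding layer_tree (node i z)"
  shows "gap d A x y = (d - i) + max (gap i A x z) (gap i A y z)"
proof -
  have eq_z: "A j u = A j z \<longleftrightarrow> j + gap i A u z \<le> i" if "j \<le> i" "u \<in> V" for j u
    using eq_iff_gap[of u z j i] V i that by simp
  have gap: "gap d A u w = d - j" if "u \<in> V" "w \<in> V" "j < d" "A j u = A j w" "A (Suc j) u \<noteq> A (Suc j) w" for u w j
    using eq_iff_gap[of u w j d] eq_iff_gap[of u w "Suc j" d] that by auto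
  have 0: "gap i A u z \<le> i" if "u \<in> V" for u
    using eq_z[of 0 u] bottom_eq[of u z] V that by simp
  \<comment> \<open>Here \<open>w\<close> leaves the chain of \<open>node i z\<close> closer to the
    root than \<open>u\<close> does, and \<open>?j\<close> is the last level that \<open>w\<close>
    shares with that chain.\<close>
  have less: "gap d A u w = (d - i) + gap i A w z"
    if "u \<in> V" "w \<in> V" and l: "gap i A u z < gap i A w z" for u w
  proof -
    let ?j = "i - gap i A w z"
    have j: "?j < i" using l 0[of w] that by simp
    have "A ?j u = A ?j z" "A ?j w = A ?j z" "A (Suc ?j) u = A (Suc ?j) z" "A (Suc ?j) w \<noteq> A (Suc ?j) z"
      using eq_z[of ?j] eq_z[of "Suc ?j"] that j 0[of w] by auto
    then have "gap d A u w = d - ?j" using gap[of u w ?j] that j i by simp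
    then show ?thesis using 0[of w] that i by simp
  qed
  consider "gap i A x z < gap i A y z" | "gap i A y z < gap i A x z" | "gap i A x z = gap i A y z"
    by linarith
  then show ?thesis
  proof cases
    case 1
    then show ?thesis using less[of x y] V by simp
  next
    case 2
    then show ?thesis using less[of y x] V gap_comm[of d A x y] by simp
  next
    case 3
    define g where "g = gap i A x z"
    have g: "gap i A x z = g" "gap i A y z = g" "g \<le> i" using 3 0[of x] V by (auto simp: g_def)
    have "A (i - g) x = A (i - g) z" "A (i - g) y = A (i - g) z"
      using eq_z[of "i - g" x] eq_z[of "i - g" y] V g by auto
    then have c: "A (i - g) x = A (i - g) y" by simp
    show ?thesis
    proof (cases "g = 0")
      case True
      have "A (Suc i) x \<noteq> A (Suc i) y"
      proof
        assume "A (Suc i) x = A (Suc i) y"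
        then have "(node d x, node d y) \<in> conn_avoiding layer_tree (node i z)"
          using V i by (intro connected_above[of x y "Suc i"]) (auto simp: node_eq_iff)
        with disc show False ..
      qed
      then show ?thesis using gap[of x y i] V i c True g by simp
    next
      case False
      have "A i x \<noteq> A i z" "A i y \<noteq> A i z"
        using eq_z[of i x] eq_z[of i y] V g False by auto
      then have "(node d x, node d y) \<in> conn_avoiding layer_tree (node i z)"
        using V i c g by (intro connected_above[of x y "i - g"]) (auto simp: node_eq_iff)
      with disc show ?thesis ..
    qed
  qed
qed

end

text \<open>As long as level 1 is constant, level 0 can be deleted: it never contributes to
  \<open>gap\<close>, so the labels remain valid. With two vertices this stops before the depth
  reaches 0.\<close>

lemma graph_layering_drop_constant:
  assumes "graph_layering k d G A f" "2 \<le> card (pverts G)"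
  shows "\<exists>d' A'. d' \<le> d \<and> graph_layering k d' G A' f \<and> branching_layers (pverts G) d' A'"
  using assms(1)
proof (induction d arbitrary: A)
  case 0
  then have "inj_on (A 0) (pverts G)" "\<forall>x \<in> pverts G. \<forall>y \<in> pverts G. A 0 x = A 0 y" "finite (pverts G)"
    unfolding graph_layering_def layering_def by blast+
  then have "\<forall>x \<in> pverts G. \<forall>y \<in> pverts G. x = y" "finite (pverts G)"
    unfolding inj_on_def by blast+
  then have "card (pverts G) \<le> Suc 0"
    by (simp only: card_le_Suc0_iff_eq)
  with assms(2) show ?case by linarith
next
  case (Suc d)
  show ?case
  proof (cases "\<exists>x \<in> pverts G. \<exists>y \<in> pverts G. A 1 x \<noteq> A 1 y")
    case True
    have "branching_layers (pverts G) (Suc d) A"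
      using Suc.prems True by unfold_locales (auto simp: graph_layering_def)
    then show ?thesis using Suc.prems by blast
  next
    case False
    let ?A = "\<lambda>j. A (Suc j)"
    have lay: "layering (pverts G) (Suc d) A" using Suc.prems by (simp add: graph_layering_def)
    have gap_eq: "gap d ?A x y = gap (Suc d) A x y" if "x \<in> pverts G" "y \<in> pverts G" for x y
    proof -
      have 0: "A 0 x = A 0 y" using lay that unfolding layering_def by blast
      have "{j. j \<le> Suc d \<and> A j x \<noteq> A j y} = Suc ` {j. j \<le> d \<and> ?A j x \<noteq> ?A j y}"
      proof (rule set_eqI)
        fix j
        show "j \<in> {j. j \<le> Suc d \<and> A j x \<noteq> A j y} \<longleftrightarrow> j \<in> Suc ` {j. j \<le> d \<and> ?A j x \<noteq> ?A j y}"
          using 0 by (cases j) auto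
      qed
      then show ?thesis by (simp add: gap_def card_image)
    qed
    have lay': "layering (pverts G) d ?A"
    proof -
      have "\<forall>x \<in> pverts G. \<forall>y \<in> pverts G. ?A 0 x = ?A 0 y"
        using False unfolding One_nat_def by blast
      moreover have "\<forall>j < d. \<forall>x \<in> pverts G. \<forall>y \<in> pverts G. ?A (Suc j) x = ?A (Suc j) y \<longrightarrow> ?A j x = ?A j y"
        using lay unfolding layering_def by (meson Suc_mono)
      ultimately show ?thesis using lay unfolding layering_def by blast
    qed
    have "graph_layering k d G ?A f"
      unfolding graph_layering_def
    proof (intro conjI lay' ballI impI)
      fix x\<^sub>1 y\<^sub>1 x\<^sub>2 y\<^sub>2
      assume V: "x\<^sub>1 \<in> pverts G" "y\<^sub>1 \<in> pverts G" "x\<^sub>2 \<in> pverts G" "y\<^sub>2 \<in> pverts G"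
        and eq: "gap d ?A x\<^sub>1 y\<^sub>1 = gap d ?A x\<^sub>2 y\<^sub>2 \<and> f x\<^sub>1 = f x\<^sub>2 \<and> f y\<^sub>1 = f y\<^sub>2"
      have "gap (Suc d) A x\<^sub>1 y\<^sub>1 = gap (Suc d) A x\<^sub>2 y\<^sub>2"
        using eq unfolding gap_eq[OF V(1,2)] gap_eq[OF V(3,4)] by blast
      then show "(x\<^sub>1, y\<^sub>1) \<in> parcs G \<longleftrightarrow> (x\<^sub>2, y\<^sub>2) \<in> parcs G"
        using Suc.prems V eq unfolding graph_layering_def by blast
    qed (use Suc.prems in \<open>simp add: graph_layering_def\<close>)
    then show ?thesis using Suc.IH le_SucI by blast
  qed
qed

lemma kr_decomposition_mono:
  "kr_decomposition k r E l T \<sigma> \<Longrightarrow> k \<le> k' \<Longrightarrow> r \<le> r' \<Longrightarrow> kr_decomposition k' r' E l T \<sigma>"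
  unfolding kr_decomposition_def by auto

text \<open>A union of parts \<open>?X\<close> is closed under connection avoiding \<open>v\<close>,
  so \<open>gap_disconnected\<close> applies to each \<open>x\<close> in \<open>?X\<close> and each
  column \<open>y\<close> outside. The label of \<open>x\<close> and its branching level relative to
  \<open>v\<close> therefore fix its entry in column \<open>y\<close>.\<close>

lemma graph_layering_imp_kr_decomposition:
  fixes G :: "'a pair_pre_digraph"
  assumes "graph_layering k d G A f" "2 \<le> card (pverts G)"
  shows "\<exists>(T :: nat pair_pre_digraph) \<sigma>.
    kr_decomposition (k * Suc d) d (pverts G) (\<lambda>X. int (cut_rank G X)) T \<sigma>"
proof -
  obtain d' A' where d': "d' \<le> d" and lay: "graph_layering k d' G A' f"
    and "branching_layers (pverts G) d' A'"
    using graph_layering_drop_constant[OF assms] by blast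
  then interpret branching_layers "pverts G" d' A' by simp
  have rank: "cut_rank G (\<Union>P) \<le> k * Suc d'"
    if v: "v \<in> internal_nodes layer_tree" and P: "P \<subseteq> node_partition (pverts G) layer_tree (node d') v" for v P
  proof -
    let ?X = "\<Union>P"
    have v': "v \<in> nodes" "height v < d'" using v by (auto simp: internal_nodes_layer_tree)
    obtain i z where i: "i \<le> d'" "z \<in> pverts G" "v = node i z" using v'(1) by (rule nodesE)
    with v' have "i < d'" by (simp add: height_node)
    have X: "?X \<subseteq> pverts G" using P by (auto simp: node_partition_def)
    have closed: "y \<in> ?X"
      if "x \<in> ?X" "y \<in> pverts G" "(node d' x, node d' y) \<in> conn_avoiding layer_tree v" for x y
    proof -
      obtain p where p: "p \<in> P" "x \<in> p" using \<open>x \<in> ?X\<close> by blast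
      then obtain a where a: "p = {e \<in> pverts G. node d' e \<in> conn_avoiding layer_tree v `` {a}}"
        using P by (auto simp: node_partition_def T.sccs_verts_del_vert)
      then have "(a, node d' y) \<in> conn_avoiding layer_tree v"
        using p that unfolding conn_avoiding_def by (auto intro: rtrancl_trans)
      then show ?thesis using a p that by auto
    qed
    have finX: "finite ?X" using X finite_V by (rule finite_subset)
    have determined: "cut_row G ?X x = cut_row G ?X x'"
      if x: "x \<in> ?X" "x' \<in> ?X" and eq: "(f x, gap i A' x z) = (f x', gap i A' x' z)" for x x'
    proof -
      have "(x, y) \<in> parcs G \<longleftrightarrow> (x', y) \<in> parcs G" if y: "y \<in> pverts G - ?X" for y
      proof -
        have "(node d' x, node d' y) \<notin> conn_avoiding layer_tree v"
          "(node d' x', node d' y) \<notin> conn_avoiding layer_tree v"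
          using closed x y by blast+
        then have "gap d' A' x y = gap d' A' x' y"
          using gap_disconnected[of x y z i] gap_disconnected[of x' y z i] subsetD[OF X x(1)]
            subsetD[OF X x(2)] y i \<open>i < d'\<close> eq by simp
        moreover have "x \<in> pverts G" "x' \<in> pverts G" "y \<in> pverts G" "f x = f x'"
          using x y X eq by blast+
        ultimately show ?thesis
          using lay unfolding graph_layering_def by blast
      qed
      then show ?thesis unfolding cut_row_def by (intro ext) auto
    qed
    have "card (cut_row G ?X ` ?X) \<le> card ((\<lambda>x. (f x, gap i A' x z)) ` ?X)"
      using finX determined by (rule card_image_le_if_determined)
    \<comment> \<open>By \<open>gap_le\<close> the branching value is at most \<open>Suc i\<close>,
      and \<open>i < d'\<close>; this leaves \<open>Suc d'\<close> values next to \<open>k\<close>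
      labels.\<close>
    also have "\<dots> \<le> card ({1..k} \<times> {..d'})"
    proof (intro card_mono)
      have "gap i A' x z \<le> d'" for x using gap_le[of i A' x z] \<open>i < d'\<close> by simp
      then show "(\<lambda>x. (f x, gap i A' x z)) ` ?X \<subseteq> {1..k} \<times> {..d'}"
        using lay X unfolding graph_layering_def by blast
    qed simp
    also have "\<dots> = k * Suc d'" by (simp add: card_cartesian_product)
    finally show ?thesis
      unfolding cut_rank_def using dim_le_card_rows[of "cut_row G ?X ` ?X"] finX by simp
  qed
  have "int (cut_rank G (\<Union>P)) \<le> int (k * Suc d)"
    if "v \<in> internal_nodes layer_tree" "P \<subseteq> node_partition (pverts G) layer_tree (node d') v" for v P
    using rank[OF that] d' by (meson Suc_le_mono le_trans mult_le_mono2 of_nat_mono)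
  then have "kr_decomposition (k * Suc d) d (pverts G) (\<lambda>X. int (cut_rank G X)) layer_tree (node d')"
    unfolding kr_decomposition_def
    using decomposition_layer_tree radius_layer_tree d'
    by (subst T.decomposition_width_le_iff) (auto simp: decomposition_def)
  then show ?thesis by blast
qed

text \<open>Needed for the \<open>LEAST\<close> in \<open>branch_depth\<close> to be attained. The
  star comes from a layering of depth one; injective labels make the adjacency condition
  trivial.\<close>

lemma ex_kr_decomposition:
  fixes G :: "'a pair_pre_digraph"
  assumes "finite (pverts G)" "2 \<le> card (pverts G)"
  shows "\<exists>k. \<exists>(T :: nat pair_pre_digraph) \<sigma>.
    kr_decomposition k k (pverts G) (\<lambda>X. int (cut_rank G X)) T \<sigma>"
proof -
  obtain e where e: "bij_betw e (pverts G) {1..card (pverts G)}"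
    using ex_bij_betw_nat_finite_1[OF assms(1)] bij_betw_inv by blast
  let ?A = "\<lambda>j x. if j = 0 then 0 else e x"
  have e_in: "e x \<in> {1..card (pverts G)}" if "x \<in> pverts G" for x
    using bij_betwE[OF e] that by blast
  have inj: "x = y" if "x \<in> pverts G" "y \<in> pverts G" "e x = e y" for x y
    using e that by (auto simp: bij_betw_def inj_on_def)
  have "layering (pverts G) 1 ?A"
    using assms inj by (auto simp: layering_def inj_on_def)
  then have "graph_layering (card (pverts G)) 1 G ?A e"
    unfolding graph_layering_def using e_in inj by blast
  from graph_layering_imp_kr_decomposition[OF this assms(2)]
  obtain T :: "nat pair_pre_digraph" and \<sigma> where
    "kr_decomposition (card (pverts G) * Suc 1) 1 (pverts G) (\<lambda>X. int (cut_rank G X)) T \<sigma>"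
    by blast
  then have "kr_decomposition (card (pverts G) * Suc 1) (card (pverts G) * Suc 1)
      (pverts G) (\<lambda>X. int (cut_rank G X)) T \<sigma>"
    by (rule kr_decomposition_mono) (use assms(2) in simp_all)
  then show ?thesis by blast
qed

text \<open>One number has to bound both width \<open>k * Suc d\<close> and radius \<open>d\<close>;
  the extra \<open>Suc\<close> covers \<open>k = 0\<close>.\<close>

lemma rank_depth_le:
  assumes "graph_layering k d G A f"
  shows "rank_depth G \<le> Suc k * Suc d"
proof (cases "2 \<le> card (pverts G)")
  case True
  obtain T :: "nat pair_pre_digraph" and \<sigma> where
    "kr_decomposition (k * Suc d) d (pverts G) (\<lambda>X. int (cut_rank G X)) T \<sigma>"
    using graph_layering_imp_kr_decomposition[OF assms True] by blast
  then have "kr_decomposition (Suc k * Suc d) (Suc k * Suc d) (pverts G) (\<lambda>X. int (cut_rank G X)) T \<sigma>"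
    by (rule kr_decomposition_mono) auto
  then show ?thesis
    unfolding rank_depth_def branch_depth_def using True by (auto intro!: Least_le)
qed (simp add: rank_depth_def branch_depth_def)

lemma kr_decomposition_of_rank_depth:
  fixes G :: "'a pair_pre_digraph"
  assumes "finite (pverts G)" "2 \<le> card (pverts G)" "rank_depth G \<le> n"
  shows "\<exists>(T :: nat pair_pre_digraph) \<sigma>.
    kr_decomposition n n (pverts G) (\<lambda>X. int (cut_rank G X)) T \<sigma>"
proof -
  let ?P = "\<lambda>k. \<exists>(T :: nat pair_pre_digraph) \<sigma>. kr_decomposition k k (pverts G) (\<lambda>X. int (cut_rank G X)) T \<sigma>"
  have "?P (LEAST k. ?P k)"
    using ex_kr_decomposition[OF assms(1,2)] by (rule LeastI_ex)
  then have "?P (rank_depth G)"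
    using assms(2) by (simp add: rank_depth_def branch_depth_def)
  then show ?thesis using kr_decomposition_mono assms(3) by blast
qed

section \<open>From decompositions to layerings\<close>

text \<open>With \<open>N = side_bound (2 ^ n)\<close> types at a node there are
  \<open>2 ^ (N * N)\<close> adjacency tables. A label holds one type and one table for each of the
  levels below \<open>2 * n\<close>, the levels on which two leaves can agree for the last
  time.\<close>

definition label_bound :: "nat \<Rightarrow> nat" where
  "label_bound n = (side_bound (2 ^ n) * 2 ^ (side_bound (2 ^ n) * side_bound (2 ^ n))) ^ (2 * n)"

lemma side_bound_pos: "0 < side_bound K"
  by (simp add: side_bound_def)

lemma label_bound_pos: "0 < label_bound n"
  by (simp add: label_bound_def side_bound_pos)

section \<open>Decompositions as rooted trees\<close>

context parent_tree
begin

text \<open>A leaf has degree one and, as the root is internal, its single neighbour is its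
  parent.\<close>

lemma leaf_no_child:
  assumes "u \<in> leaves T" "r \<in> internal_nodes T" "w \<in> pverts T" "w \<noteq> r"
  shows "par w \<noteq> u"
proof
  assume "par w = u"
  have u: "u \<in> pverts T" "card {w. (u, w) \<in> parcs T} = 1"
    using assms(1) by (simp_all add: leaves_def out_degree_eq_card)
  have "u \<noteq> r" using assms(1,2) by (auto simp: leaves_def internal_nodes_def)
  have "(u, w) \<in> parcs T" "(u, par u) \<in> parcs T"
    using par_arc[OF assms(3,4)] par_arc[OF u(1) \<open>u \<noteq> r\<close>] \<open>par w = u\<close> by simp_all
  moreover have "par u \<noteq> w"
    using par_neq_child[OF u(1) \<open>u \<noteq> r\<close> assms(3,4) \<open>par w = u\<close>] .
  moreover obtain z where "{w. (u, w) \<in> parcs T} = {z}"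
    using u(2) by (rule card_1_singletonE)
  ultimately show False by (metis mem_Collect_eq singletonD)
qed

lemma two_children_internal:
  assumes "a \<in> pverts T" "b \<in> pverts T" "a \<noteq> r" "b \<noteq> r" "par a = v" "par b = v" "a \<noteq> b"
  shows "v \<in> internal_nodes T"
proof -
  have arcs: "(v, a) \<in> parcs T" "(v, b) \<in> parcs T"
    using par_arc[OF assms(1,3)] par_arc[OF assms(2,4)] assms(5,6) by simp_all
  have "{w. (v, w) \<in> parcs T} \<subseteq> pverts T" using wellformed'(2) by blast
  then have "finite {w. (v, w) \<in> parcs T}" using finite_nodes by (rule finite_subset)
  moreover have "{a, b} \<subseteq> {w. (v, w) \<in> parcs T}" using arcs by simp
  ultimately have "card {a, b} \<le> card {w. (v, w) \<in> parcs T}" by (rule card_mono)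
  then show ?thesis
    using assms(7) wellformed'(1)[OF arcs(1)] by (simp add: internal_nodes_def out_degree_eq_card)
qed

text \<open>The delicate case is a branch that has already ended at level \<open>i\<close>. Then
  \<open>v\<close> would be that leaf itself, and the other branch would pass through it to a child,
  which leaves do not have. So both branches enter different children of \<open>v\<close>.\<close>

lemma diverging_leaves:
  assumes r: "r \<in> internal_nodes T" and leaf: "a \<in> leaves T" "b \<in> leaves T"
    and eq: "anc i a = v" "anc i b = v" and neq: "anc (Suc i) a \<noteq> anc (Suc i) b"
  shows "v \<in> internal_nodes T" "(a, b) \<notin> conn_avoiding T v"
proof -
  have in_T: "a \<in> pverts T" "b \<in> pverts T" using leaf by (simp_all add: leaves_def)
  have child: "anc (Suc i) x \<in> pverts T \<and> anc (Suc i) x \<noteq> r \<and> par (anc (Suc i) x) = anc i x \<and> h (anc (Suc i) x) = Suc i"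
    if "x \<in> pverts T" "i < h x" for x
  proof -
    have "h (anc (Suc i) x) = Suc i" using anc_in_height(2)[OF that(1), of "Suc i"] that(2) by simp
    moreover then have "anc (Suc i) x \<noteq> r" using height_root by auto
    ultimately show ?thesis
      using anc_in_height(1)[OF that(1)] par_anc_Suc[OF that] by simp
  qed
  have deep: "i < h x"
    if "x \<in> leaves T" "x \<in> pverts T" "y \<in> pverts T" "anc i x = v" "anc i y = v" "anc (Suc i) x \<noteq> anc (Suc i) y" for x y
  proof (rule ccontr)
    assume "\<not> i < h x"
    then have x: "anc i x = x" "anc (Suc i) x = x" by (simp_all add: anc_ge)
    have "i < h y"
    proof (rule ccontr)
      assume "\<not> i < h y"
      then have "anc i y = y" "anc (Suc i) y = y" by (simp_all add: anc_ge)
      then show False using that x by simp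
    qed
    from child[OF that(3) this] have "par (anc (Suc i) y) = x" "anc (Suc i) y \<in> pverts T" "anc (Suc i) y \<noteq> r"
      using that x by simp_all
    then show False using leaf_no_child[OF that(1) r] by blast
  qed
  have "i < h a" using deep[OF leaf(1) in_T eq neq] .
  note ca = child[OF in_T(1) this]
  have "i < h b" using deep[OF leaf(2) in_T(2,1) eq(2,1) neq[symmetric]] .
  note cb = child[OF in_T(2) this]
  show "v \<in> internal_nodes T"
    using two_children_internal[of "anc (Suc i) a" "anc (Suc i) b" v] ca cb eq neq by simp
  show "(a, b) \<notin> conn_avoiding T v"
  proof
    assume "(a, b) \<in> conn_avoiding T v"
    then have "anc (Suc i) b = anc (Suc i) a"
      using conn_avoiding_below[of a b v i "anc (Suc i) a"] in_T ca eq by simp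
    with neq show False by simp
  qed
qed

lemma graph_dist_triangle:
  assumes "u \<in> pverts T" "v \<in> pverts T" "w \<in> pverts T"
  shows "graph_dist T u w \<le> graph_dist T u v + graph_dist T v w"
proof -
  have "(u, w) \<in> parcs T ^^ (apart u v + apart v w)"
    unfolding relpow_add using relpow_apart assms by blast
  from apart_le_relpow[OF this] show ?thesis using graph_dist_eq_apart assms by simp
qed

text \<open>The root need not be a centre; the detour through a centre costs a factor of two, which
  is where depth \<open>2 * n\<close> comes from.\<close>

lemma height_le_twice_radius:
  assumes "v \<in> pverts T"
  shows "h v \<le> 2 * radius T"
proof -
  let ?P = "\<lambda>m. \<exists>u \<in> pverts T. \<forall>v \<in> pverts T. graph_dist T u v \<le> m"
  have "\<forall>v \<in> pverts T. graph_dist T r v \<le> Max (graph_dist T r ` pverts T)"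
    using finite_nodes by simp
  then have "\<exists>m. ?P m" using root_in by blast
  then have "?P (radius T)" unfolding radius_def by (rule LeastI_ex)
  then obtain c where c: "c \<in> pverts T" "\<And>v. v \<in> pverts T \<Longrightarrow> graph_dist T c v \<le> radius T" by blast
  have "graph_dist T r c = graph_dist T c r"
    using graph_dist_eq_apart c(1) root_in apart_comm by simp
  then have "graph_dist T r v \<le> radius T + radius T"
    using graph_dist_triangle[OF root_in c(1) assms] c(2)[OF assms] c(2)[OF root_in] by linarith
  then show ?thesis using graph_dist_root[OF assms] by simp
qed

text \<open>Instance of \<open>bounded_types_across_parts\<close> with the components of
  \<open>T - v\<close> as parts and \<open>K = 2 ^ n\<close>, the number of rows possible at rank
  \<open>n\<close>.\<close>

lemma bounded_types_at_node:
  fixes G :: "'a pair_pre_digraph"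
  assumes G: "pair_graph G" and \<sigma>: "\<And>x. x \<in> pverts G \<Longrightarrow> \<sigma> x \<in> leaves T"
    and v: "v \<in> internal_nodes T"
    and width: "\<And>P. P \<subseteq> node_partition (pverts G) T \<sigma> v \<Longrightarrow> cut_rank G (\<Union>P) \<le> n"
  shows "\<exists>g :: 'a \<Rightarrow> nat. (\<forall>x \<in> pverts G. g x < side_bound (2 ^ n)) \<and>
    (\<forall>x \<in> pverts G. \<forall>y \<in> pverts G. \<forall>x' \<in> pverts G. \<forall>y' \<in> pverts G.
       (\<sigma> x, \<sigma> y) \<notin> conn_avoiding T v \<longrightarrow> (\<sigma> x', \<sigma> y') \<notin> conn_avoiding T v \<longrightarrow>
       g x = g x' \<longrightarrow> g y = g y' \<longrightarrow> ((x, y) \<in> parcs G \<longleftrightarrow> (x', y') \<in> parcs G))"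
proof -
  interpret G: pair_graph G by (rule G)
  let ?p = "\<lambda>x. conn_avoiding T v `` {\<sigma> x}"
  let ?M = "\<lambda>x y. (x, y) \<in> parcs G"
  have refl: "\<sigma> x \<in> ?p x" for x by (simp add: conn_avoiding_def)
  have trans: "trans (conn_avoiding T v)" by (simp add: conn_avoiding_def trans_rtrancl)
  have eq: "?p x = ?p y" if "(\<sigma> x, \<sigma> y) \<in> conn_avoiding T v" for x y
    using that trans conn_avoiding_sym[of v] by (auto dest: transD symD)
  have rows: "card (rows_across (pverts G) ?M ?p B ` {x \<in> pverts G. ?p x \<in> B}) \<le> 2 ^ n" for B
  proof -
    let ?X = "{x \<in> pverts G. ?p x \<in> B}"
    \<comment> \<open>\<open>B\<close> is an arbitrary family of node sets; only its members that
      are components of some \<open>\<sigma> x\<close> matter, and these yield elements of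
      \<open>node_partition\<close>.\<close>
    let ?P = "(\<lambda>x. {e \<in> pverts G. \<sigma> e \<in> ?p x}) ` ?X"
    have "\<Union>?P = ?X"
    proof (intro set_eqI iffI)
      fix e assume "e \<in> \<Union>?P"
      then obtain x where x: "x \<in> ?X" "e \<in> pverts G" "(\<sigma> x, \<sigma> e) \<in> conn_avoiding T v" by blast
      from eq[OF x(3)] x(1,2) show "e \<in> ?X" by simp
    next
      fix e assume "e \<in> ?X"
      with refl show "e \<in> \<Union>?P" by blast
    qed
    moreover have "?P \<subseteq> node_partition (pverts G) T \<sigma> v"
    proof
      fix S assume "S \<in> ?P"
      then obtain x where x: "x \<in> pverts G" "S = {e \<in> pverts G. \<sigma> e \<in> ?p x}" by blast
      have "\<sigma> x \<in> pverts T - {v}" using \<sigma>[OF x(1)] v by (auto simp: leaves_def internal_nodes_def)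
      then show "S \<in> node_partition (pverts G) T \<sigma> v"
        unfolding node_partition_def sccs_verts_del_vert x(2) by blast
    qed
    ultimately have "cut_rank G ?X \<le> n" using width[of ?P] by simp
    moreover have fin: "finite ?X" using G.pair_finite_verts by simp
    then have "card (cut_row G ?X ` ?X) \<le> 2 ^ cut_rank G ?X"
      unfolding cut_rank_def by (intro card_le_two_power_dim) simp
    moreover have "rows_across (pverts G) ?M ?p B x = {y. cut_row G ?X x y = 1}" for x
      by (auto simp: rows_across_def cut_row_def)
    then have "card (rows_across (pverts G) ?M ?p B ` ?X) \<le> card (cut_row G ?X ` ?X)"
      using fin by (intro card_image_le_if_determined) simp_all
    moreover have "(2 :: nat) ^ cut_rank G ?X \<le> 2 ^ n"
      using \<open>cut_rank G ?X \<le> n\<close> by (intro power_increasing) simp_all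
    ultimately show ?thesis by linarith
  qed
  have sym: "?M x y \<longleftrightarrow> ?M y x" for x y using G.arcs_symmetric by blast
  obtain g :: "'a \<Rightarrow> nat" where g: "\<forall>x \<in> pverts G. g x < side_bound (2 ^ n)"
    "\<forall>x \<in> pverts G. \<forall>y \<in> pverts G. \<forall>x' \<in> pverts G. \<forall>y' \<in> pverts G. ?p x \<noteq> ?p y \<longrightarrow> ?p x' \<noteq> ?p y' \<longrightarrow>
      g x = g x' \<longrightarrow> g y = g y' \<longrightarrow> ?M x y = ?M x' y'"
    using bounded_types_across_parts[of "pverts G" ?M ?p, OF G.pair_finite_verts sym rows] by (elim exE conjE)
  have neq: "?p x \<noteq> ?p y" if "(\<sigma> x, \<sigma> y) \<notin> conn_avoiding T v" for x y
    using that refl[of y] by auto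
  show ?thesis
  proof (intro exI[of _ g] conjI g(1) ballI impI)
    fix x y x' y'
    assume V: "x \<in> pverts G" "y \<in> pverts G" "x' \<in> pverts G" "y' \<in> pverts G"
      and d: "(\<sigma> x, \<sigma> y) \<notin> conn_avoiding T v" "(\<sigma> x', \<sigma> y') \<notin> conn_avoiding T v"
      and e: "g x = g x'" "g y = g y'"
    show "(x, y) \<in> parcs G \<longleftrightarrow> (x', y') \<in> parcs G"
      using g(2)[rule_format, OF V neq[OF d(1)] neq[OF d(2)] e] .
  qed
qed

end

text \<open>
  The label of a vertex records, for each level, its type at its ancestor on that level together with
  the table that decides adjacency of vertices diverging there from their types.
\<close>

lemma kr_decomposition_imp_graph_layering:
  fixes G :: "'a pair_pre_digraph" and T :: "nat pair_pre_digraph"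
  assumes G: "pair_graph G" and ne: "pverts G \<noteq> {}"
    and kr: "kr_decomposition n n (pverts G) (\<lambda>X. int (cut_rank G X)) T \<sigma>"
  shows "\<exists>A f. graph_layering (label_bound n) (2 * n) G A f"
proof -
  let ?V = "pverts G" and ?N = "side_bound (2 ^ n)" and ?d = "2 * n"
  interpret G: pair_graph G by (rule G)
  have dec: "is_tree T" "internal_nodes T \<noteq> {}" "bij_betw \<sigma> ?V (leaves T)" "radius T \<le> n"
    and width: "decomposition_width ?V (\<lambda>X. int (cut_rank G X)) T \<sigma> \<le> int n"
    using kr by (auto simp: kr_decomposition_def decomposition_def)
  obtain r where r: "r \<in> internal_nodes T" using dec(2) by blast
  then have "r \<in> pverts T" by (simp add: internal_nodes_def)
  from is_tree_imp_parent_tree[OF dec(1) this]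
  obtain par where "parent_tree T r par (graph_dist T r)" ..
  then interpret parent_tree T r par "graph_dist T r" .
  have leaf: "\<sigma> x \<in> leaves T" if "x \<in> ?V" for x using bij_betwE[OF dec(3)] that by blast
  have in_T: "\<sigma> x \<in> pverts T" if "x \<in> ?V" for x using leaf[OF that] by (simp add: leaves_def)
  define A where "A j x = anc j (\<sigma> x)" for j x
  have "graph_dist T r (\<sigma> x) \<le> ?d" if "x \<in> ?V" for x
    using height_le_twice_radius[OF in_T[OF that]] dec(4) by linarith
  then have "layering ?V ?d A"
    unfolding A_def
    using G.pair_finite_verts ne in_T dec(3)
    by (intro layering_ancestors[OF parent_tree_axioms]) (simp_all add: bij_betw_def)
  then interpret L: layers ?V ?d A by unfold_locales

  have "\<forall>v \<in> internal_nodes T. \<exists>g :: 'a \<Rightarrow> nat. (\<forall>x \<in> ?V. g x < ?N) \<and>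
    (\<forall>x \<in> ?V. \<forall>y \<in> ?V. \<forall>x' \<in> ?V. \<forall>y' \<in> ?V.
       (\<sigma> x, \<sigma> y) \<notin> conn_avoiding T v \<longrightarrow> (\<sigma> x', \<sigma> y') \<notin> conn_avoiding T v \<longrightarrow>
       g x = g x' \<longrightarrow> g y = g y' \<longrightarrow> ((x, y) \<in> parcs G \<longleftrightarrow> (x', y') \<in> parcs G))"
  proof
    fix v assume v: "v \<in> internal_nodes T"
    have "cut_rank G (\<Union>P) \<le> n" if "P \<subseteq> node_partition ?V T \<sigma> v" for P
      using width v that unfolding decomposition_width_le_iff[OF dec(2)] by simp
    from bounded_types_at_node[OF G leaf v this]
    show "\<exists>g :: 'a \<Rightarrow> nat. (\<forall>x \<in> ?V. g x < ?N) \<and>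
      (\<forall>x \<in> ?V. \<forall>y \<in> ?V. \<forall>x' \<in> ?V. \<forall>y' \<in> ?V.
         (\<sigma> x, \<sigma> y) \<notin> conn_avoiding T v \<longrightarrow> (\<sigma> x', \<sigma> y') \<notin> conn_avoiding T v \<longrightarrow>
         g x = g x' \<longrightarrow> g y = g y' \<longrightarrow> ((x, y) \<in> parcs G \<longleftrightarrow> (x', y') \<in> parcs G))" .
  qed
  from bchoice[OF this] obtain g :: "nat \<Rightarrow> 'a \<Rightarrow> nat" where
    g: "\<forall>v \<in> internal_nodes T. (\<forall>x \<in> ?V. g v x < ?N) \<and>
    (\<forall>x \<in> ?V. \<forall>y \<in> ?V. \<forall>x' \<in> ?V. \<forall>y' \<in> ?V.
       (\<sigma> x, \<sigma> y) \<notin> conn_avoiding T v \<longrightarrow> (\<sigma> x', \<sigma> y') \<notin> conn_avoiding T v \<longrightarrow>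
       g v x = g v x' \<longrightarrow> g v y = g v y' \<longrightarrow> ((x, y) \<in> parcs G \<longleftrightarrow> (x', y') \<in> parcs G))" ..
  \<comment> \<open>Equal type numbers at two different nodes mean nothing by themselves. The table
    expresses adjacency through numbers alone, so that it can be compared between nodes.\<close>
  define tab where "tab v = {(g v x, g v y) | x y. x \<in> ?V \<and> y \<in> ?V \<and>
      (\<sigma> x, \<sigma> y) \<notin> conn_avoiding T v \<and> (x, y) \<in> parcs G}" for v
  have g_less: "g v x < ?N" if "v \<in> internal_nodes T" "x \<in> ?V" for v x
    using g that by blast
  have tab_sub: "tab v \<subseteq> {..<?N} \<times> {..<?N}" if "v \<in> internal_nodes T" for v
    using g_less[OF that] by (auto simp: tab_def)
  have tab: "(x, y) \<in> parcs G \<longleftrightarrow> (g v x, g v y) \<in> tab v"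
    if "v \<in> internal_nodes T" "x \<in> ?V" "y \<in> ?V" "(\<sigma> x, \<sigma> y) \<notin> conn_avoiding T v" for v x y
  proof
    assume "(x, y) \<in> parcs G"
    then show "(g v x, g v y) \<in> tab v" using that unfolding tab_def by blast
  next
    assume "(g v x, g v y) \<in> tab v"
    then obtain x' y' where *: "x' \<in> ?V" "y' \<in> ?V" "(\<sigma> x', \<sigma> y') \<notin> conn_avoiding T v" "(x', y') \<in> parcs G"
      "g v x = g v x'" "g v y = g v y'"
      unfolding tab_def by blast
    from g that(1) have "(x, y) \<in> parcs G \<longleftrightarrow> (x', y') \<in> parcs G"
      using that(2-4) * by blast
    with * show "(x, y) \<in> parcs G" by simp
  qed
  \<comment> \<open>The default occurs where the ancestor is not internal, in particular on
    prolonged branches. Pairs never diverge there, and the default stays within the counted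
    range.\<close>
  define c where "c i x = (if A i x \<in> internal_nodes T then (g (A i x) x, tab (A i x)) else (0, {}))" for i x
  have "card (c i ` ?V) \<le> ?N * 2 ^ (?N * ?N)" for i
  proof -
    have "c i ` ?V \<subseteq> {..<?N} \<times> Pow ({..<?N} \<times> {..<?N})"
    proof (rule image_subsetI)
      fix x assume "x \<in> ?V"
      then show "c i x \<in> {..<?N} \<times> Pow ({..<?N} \<times> {..<?N})"
        using g_less[of "A i x" x] tab_sub[of "A i x"] side_bound_pos by (simp add: c_def)
    qed
    then have "card (c i ` ?V) \<le> card ({..<?N} \<times> Pow ({..<?N} \<times> {..<?N}))"
      by (intro card_mono) simp_all
    then show ?thesis by (simp add: card_cartesian_product card_Pow)
  qed
  then have "card ((\<lambda>x. restrict (\<lambda>i. c i x) {..<?d}) ` ?V) \<le> (?N * 2 ^ (?N * ?N)) ^ card {..<?d}"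
    using G.pair_finite_verts by (intro card_restrict_image_le) simp_all
  then have "card ((\<lambda>x. restrict (\<lambda>i. c i x) {..<?d}) ` ?V) \<le> label_bound n"
    unfolding label_bound_def card_lessThan .
  from ex_nat_labels[OF G.pair_finite_verts this] obtain f :: "'a \<Rightarrow> nat" where
    f: "\<forall>x \<in> ?V. f x < label_bound n"
      "\<forall>x \<in> ?V. \<forall>y \<in> ?V. f x = f y \<longrightarrow> restrict (\<lambda>i. c i x) {..<?d} = restrict (\<lambda>i. c i y) {..<?d}"
    by (elim exE conjE)
  have f_eq: "c i x = c i y" if "x \<in> ?V" "y \<in> ?V" "f x = f y" "i < ?d" for x y i
    using f(2)[rule_format, OF that(1-3)] that(4) by (metis lessThan_iff restrict_apply')

  \<comment> \<open>The hypothesis on \<open>gap\<close> says that \<open>i\<close> is the last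
    level on which \<open>x\<close> and \<open>y\<close> agree.\<close>
  have diverge: "A i x \<in> internal_nodes T \<and> A i y = A i x \<and> (\<sigma> x, \<sigma> y) \<notin> conn_avoiding T (A i x)"
    if V: "x \<in> ?V" "y \<in> ?V" and gap: "gap ?d A x y = ?d - i" "i < ?d" for x y i
  proof -
    have *: "A i y = A i x" "A (Suc i) x \<noteq> A (Suc i) y"
      using L.eq_iff_gap[OF V, of i ?d] L.eq_iff_gap[OF V, of "Suc i" ?d] gap by simp_all
    show ?thesis
      using diverging_leaves[OF r leaf[OF V(1)] leaf[OF V(2)] A_def[symmetric]
          trans[OF A_def[symmetric] *(1)] *(2)[unfolded A_def]] *(1) by blast
  qed
  have gap_0: "x = y" if V: "x \<in> ?V" "y \<in> ?V" and "gap ?d A x y = 0" for x y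
    using L.eq_iff_gap[OF V, of ?d ?d] that L.inj_top by (simp add: inj_on_def)
  have gap_le_d: "gap ?d A x y \<le> ?d" if V: "x \<in> ?V" "y \<in> ?V" for x y
    using L.eq_iff_gap[OF V, of 0 ?d] L.bottom_eq[OF V] by simp

  have "graph_layering (label_bound n) ?d G A (\<lambda>x. Suc (f x))"
    unfolding graph_layering_def
  proof (intro conjI ballI impI)
    show "layering ?V ?d A" by (rule L.layering)
  next
    fix x assume "x \<in> ?V"
    then show "Suc (f x) \<in> {1..label_bound n}" using f(1) by (simp add: Suc_le_eq)
  next
    fix x\<^sub>1 y\<^sub>1 x\<^sub>2 y\<^sub>2
    assume V: "x\<^sub>1 \<in> ?V" "y\<^sub>1 \<in> ?V" "x\<^sub>2 \<in> ?V" "y\<^sub>2 \<in> ?V"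
      and eq: "gap ?d A x\<^sub>1 y\<^sub>1 = gap ?d A x\<^sub>2 y\<^sub>2 \<and> Suc (f x\<^sub>1) = Suc (f x\<^sub>2) \<and> Suc (f y\<^sub>1) = Suc (f y\<^sub>2)"
    show "(x\<^sub>1, y\<^sub>1) \<in> parcs G \<longleftrightarrow> (x\<^sub>2, y\<^sub>2) \<in> parcs G"
    proof (cases "gap ?d A x\<^sub>1 y\<^sub>1 = 0")
      case True
      then have "x\<^sub>1 = y\<^sub>1" "x\<^sub>2 = y\<^sub>2" using gap_0 V eq by metis+
      then show ?thesis using G.no_loops' by blast
    next
      case False
      define i where "i = ?d - gap ?d A x\<^sub>1 y\<^sub>1"
      have i: "i < ?d" "gap ?d A x\<^sub>1 y\<^sub>1 = ?d - i" "gap ?d A x\<^sub>2 y\<^sub>2 = ?d - i"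
        using False gap_le_d[OF V(1,2)] eq by (simp_all add: i_def)
      note d1 = diverge[OF V(1,2) i(2,1)] and d2 = diverge[OF V(3,4) i(3,1)]
      have "c i x\<^sub>1 = c i x\<^sub>2" "c i y\<^sub>1 = c i y\<^sub>2"
        using f_eq[OF V(1,3) _ i(1)] f_eq[OF V(2,4) _ i(1)] eq by simp_all
      then have "g (A i x\<^sub>1) x\<^sub>1 = g (A i x\<^sub>2) x\<^sub>2" "g (A i x\<^sub>1) y\<^sub>1 = g (A i x\<^sub>2) y\<^sub>2" "tab (A i x\<^sub>1) = tab (A i x\<^sub>2)"
        using d1 d2 by (simp_all add: c_def)
      then show ?thesis
        using tab[of "A i x\<^sub>1" x\<^sub>1 y\<^sub>1] tab[of "A i x\<^sub>2" x\<^sub>2 y\<^sub>2] V d1 d2 by simp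
    qed
  qed
  then show ?thesis by blast
qed

text \<open>Covers graphs whose rank-depth is 0 by convention, where no decomposition is at
  hand.\<close>

lemma singleton_graph_layering:
  assumes "pair_graph G" "pverts G = {v}" "0 < k"
  shows "graph_layering k d G (\<lambda>_ _. 0) (\<lambda>_. 1)"
  using assms by (simp add: graph_layering_def layering_def)

theorem theorem4p11:
  fixes \<C> :: "'a pair_pre_digraph set"
  assumes "\<And>G. G \<in> \<C> \<Longrightarrow> pair_graph G"
    and "\<And>G. G \<in> \<C> \<Longrightarrow> pverts G \<noteq> {}"
  shows "bounded_rank_depth \<C> \<longleftrightarrow> bounded_shrub_depth \<C>"
proof
  assume "bounded_rank_depth \<C>"
  then obtain n where n: "\<And>G. G \<in> \<C> \<Longrightarrow> rank_depth G \<le> n"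
    by (auto simp: bounded_rank_depth_def)
  have "\<exists>(T :: nat pair_pre_digraph) r \<sigma> f. shrubbery (label_bound n) (2 * n) G T r \<sigma> f" if G: "G \<in> \<C>" for G
  proof -
    interpret pair_graph G using assms(1)[OF G] .
    have "\<exists>A f. graph_layering (label_bound n) (2 * n) G A f"
    proof (cases "2 \<le> card (pverts G)")
      case True
      then obtain T :: "nat pair_pre_digraph" and \<sigma> where
        "kr_decomposition n n (pverts G) (\<lambda>X. int (cut_rank G X)) T \<sigma>"
        using kr_decomposition_of_rank_depth[OF pair_finite_verts True n[OF G]] by blast
      then show ?thesis
        using kr_decomposition_imp_graph_layering[OF assms[OF G]] by blast
    next
      case False
      \<comment> \<open>The empty graph has rank-depth 0 but no shrubbery, since every finite rooted
        tree has a leaf; nonemptiness excludes it.\<close>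
      have "card (pverts G) \<noteq> 0" using assms(2)[OF G] pair_finite_verts by simp
      with False have "card (pverts G) = 1" by linarith
      then obtain v where "pverts G = {v}" by (auto simp: card_1_singleton_iff)
      then show ?thesis
        using singleton_graph_layering[OF assms(1)[OF G] _ label_bound_pos] by blast
    qed
    then show ?thesis using graph_layering_imp_shrubbery by blast
  qed
  then show "bounded_shrub_depth \<C>"
    unfolding bounded_shrub_depth_def by blast
next
  assume "bounded_shrub_depth \<C>"
  then obtain k d where kd: "\<And>G. G \<in> \<C> \<Longrightarrow>
      \<exists>(T :: nat pair_pre_digraph) r \<sigma> f. shrubbery k d G T r \<sigma> f"
    unfolding bounded_shrub_depth_def by blast
  have "rank_depth G \<le> Suc k * Suc d" if G: "G \<in> \<C>" for G
  proof -
    interpret pair_graph G using assms(1)[OF G] .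
    obtain T :: "nat pair_pre_digraph" and r \<sigma> f where "shrubbery k d G T r \<sigma> f"
      using kd[OF G] by blast
    then obtain A where "graph_layering k d G A f"
      using shrubbery_imp_graph_layering[OF _ pair_finite_verts assms(2)[OF G]] by blast
    then show ?thesis by (rule rank_depth_le)
  qed
  then show "bounded_rank_depth \<C>"
    unfolding bounded_rank_depth_def by blast
qed

end
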